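(* Let $1\le p\le\infty$ and let $q$ be the conjugate exponent of $p$, i.e. $1/p+1/q=1$. Let $\mathbf{Z}=[Z_{jk}]$ be a real $m\times n$ random matrix with independent, zero-mean entries, with columns $\mathbf{z}_1,\dots,\mathbf{z}_n$, and let $\boldsymbol{\varepsilon}=(\varepsilon_i)$ be a Rademacher vector (of length $\max\{m,n\}$) independent of $\mathbf{Z}$. Then \[ \mathbb{E}\|\mathbf{Z}\|_{\infty\to p}\;\le\; 2\,\mathbb{E}\Big\|\sum_{k=1}^n \varepsilon_k\mathbf{z}_k\Big\|_p \;+\; 2\max_{\|\mathbf{u}\|_q=1}\mathbb{E}\sum_{k=1}^n\Big|\sum_{j=1}^m \varepsilon_j Z_{jk}u_j\Big|, \] where the maximum is over $\mathbf{u}\in\mathbb{R}^m$ with $\|\mathbf{u}\|_q=1$.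
   Context: All quantities are real. For a real $m\times n$ matrix $\mathbf{A}$, $\|\mathbf{A}\|_{\infty\to p}=\max_{\mathbf{u}\ne\mathbf{0}}\|\mathbf{A}\mathbf{u}\|_p/\|\mathbf{u}\|_\infty$ is the operator norm from $\ell_\infty^n$ to $\ell_p^m$. A Rademacher vector is a random vector whose components are independent and take the values $\pm1$ with probability $1/2$ each. *)

theory Defs
  imports "HOL-Probability.Probability" "Jordan_Normal_Form.Matrix"
begin

unbundle no vec_syntax

(* Exponents range over ennreal so that p = infinity is included; there 1 / infinity = 0. *)
definition lp_norm :: "ennreal \<Rightarrow> real vec \<Rightarrow> real" where
  "lp_norm p x =
     (if p = \<infinity> then Max ((\<lambda>i. \<bar>x $ i\<bar>) ` {..<dim_vec x})
      else (\<Sum>i<dim_vec x. \<bar>x $ i\<bar> powr enn2real p) powr (1 / enn2real p))"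

(* The supremum is finite and attained for 1 <= p, by compactness of the unit sphere. *)
definition opnorm_inf_to :: "ennreal \<Rightarrow> real mat \<Rightarrow> real" where
  "opnorm_inf_to p A =
     (SUP u \<in> {u \<in> carrier_vec (dim_col A). u \<noteq> 0\<^sub>v (dim_col A)}.
        lp_norm p (A *\<^sub>v u) / lp_norm \<infinity> u)"

context prob_space
begin

definition rademacher_vector :: "nat \<Rightarrow> ('a \<Rightarrow> real vec) \<Rightarrow> bool" where
  "rademacher_vector d \<epsilon> \<longleftrightarrow>
     (\<forall>\<omega>\<in>space M. \<epsilon> \<omega> \<in> carrier_vec d) \<and>
     indep_vars (\<lambda>_. borel) (\<lambda>i \<omega>. \<epsilon> \<omega> $ i) {..<d} \<and>
     (\<forall>i<d. prob {\<omega> \<in> space M. \<epsilon> \<omega> $ i = 1} = 1 / 2 \<and>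
            prob {\<omega> \<in> space M. \<epsilon> \<omega> $ i = - 1} = 1 / 2)"

definition indep_centered_matrix :: "nat \<Rightarrow> nat \<Rightarrow> ('a \<Rightarrow> real mat) \<Rightarrow> bool" where
  "indep_centered_matrix m n Z \<longleftrightarrow>
     (\<forall>\<omega>\<in>space M. Z \<omega> \<in> carrier_mat m n) \<and>
     indep_vars (\<lambda>_. borel) (\<lambda>jk \<omega>. Z \<omega> $$ jk) ({..<m} \<times> {..<n}) \<and>
     (\<forall>jk \<in> {..<m} \<times> {..<n}.
        integrable M (\<lambda>\<omega>. Z \<omega> $$ jk) \<and> expectation (\<lambda>\<omega>. Z \<omega> $$ jk) = 0)"

(* Independence of the generated sigma-algebras; indep_var would force both random elements
   to have the same value type. vec and mat carry no sigma-algebra of their own, so their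
   entries are collected into elements of finite product spaces. *)
definition indep_vec_mat ::
    "nat \<Rightarrow> nat \<Rightarrow> nat \<Rightarrow> ('a \<Rightarrow> real vec) \<Rightarrow> ('a \<Rightarrow> real mat) \<Rightarrow> bool" where
  "indep_vec_mat d m n \<epsilon> Z \<longleftrightarrow>
     indep_set
       (sets (vimage_algebra (space M)
          (\<lambda>\<omega>. \<lambda>i\<in>{..<d}. \<epsilon> \<omega> $ i) (PiM {..<d} (\<lambda>_. borel))))
       (sets (vimage_algebra (space M)
          (\<lambda>\<omega>. \<lambda>jk\<in>{..<m} \<times> {..<n}. Z \<omega> $$ jk)
          (PiM ({..<m} \<times> {..<n}) (\<lambda>_. borel))))"

end

end

theory Submission
  imports Defs
begin

text \<open>By duality, the norm from \<open>l\<^sub>\<infinity>\<close> to \<open>l\<^sub>p\<close> is the supremum of \<open>\<Sum>\<^sub>k |\<langle>z\<^sub>k, u\<rangle>|\<close> over the unit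
  sphere of \<open>l\<^sub>q\<close>. Subtracting and adding the mean of this empirical process splits its expected
  supremum into the supremum of the means and a centered part. The columns \<open>z\<^sub>k\<close> are independent, so
  symmetrization bounds the centered part by twice the expected supremum of
  \<open>\<Sum>\<^sub>k \<epsilon>\<^sub>k |\<langle>z\<^sub>k, u\<rangle>|\<close>; the contraction principle removes the absolute values, and what remains is
  the dual expression of the norm of \<open>\<Sum>\<^sub>k \<epsilon>\<^sub>k z\<^sub>k\<close>. A second symmetrization, now over the entries of each
  column, bounds the means.

  The Rademacher vector is integrated out first, so that only averages over deterministic sign
  patterns occur, and a countable dense subset of the sphere keeps all suprema measurable.\<close>

section \<open>Sign patterns and the contraction principle\<close>

text \<open>Centered entries do not make \<open>\<bar>\<langle>z\<^sub>k, u\<rangle>\<bar>\<close>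
  centered, so symmetrizing the columns alone leaves the means behind; the second term of the bound
  pays for them. Both factors 2 come from the two symmetrizations. The contraction adds no factor,
  because the suprema carry no absolute value on the outside.

  Averaging over deterministic patterns pays off twice: the contraction becomes an inequality about
  a single fixed matrix, and the entrywise symmetrization holds for every pattern separately.
  Independence of \<epsilon> and the matrix serves to pass from \<epsilon> to these averages.

  The type \<open>real vec\<close> carries neither topology nor sigma-algebra. The dual sphere is
  therefore modelled by sequences \<open>nat \<Rightarrow> real\<close> whose first \<open>m\<close>
  entries form a unit vector. The product topology there is second countable, which yields the dense
  set, and the quantities of interest are continuous because they depend on finitely many
  coordinates.\<close>

definition signs :: "'k set \<Rightarrow> ('k \<Rightarrow> real) set" where
  "signs K = K \<rightarrow>\<^sub>E {-1, 1}"

lemma finite_signs [simp]: "finite K \<Longrightarrow> finite (signs K)"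
  by (simp add: signs_def finite_PiE)

lemma card_signs: "finite K \<Longrightarrow> card (signs K) = 2 ^ card K"
  by (simp add: signs_def card_PiE numeral_2_eq_2)

lemma abs_signs: "s \<in> signs K \<Longrightarrow> k \<in> K \<Longrightarrow> \<bar>s k\<bar> = 1"
  by (auto simp: signs_def dest!: PiE_mem[where x = k])

text \<open>Conditioning on the sign at \<open>k\<close>: this recursion lets the contraction
  principle treat one coordinate at a time.\<close>

lemma sum_signs_insert:
  assumes "finite K" "k \<notin> K"
  shows "(\<Sum>s\<in>signs (insert k K). F s) = (\<Sum>s\<in>signs K. F (s(k := 1)) + F (s(k := -1)))"
proof -
  have "(\<Sum>s\<in>signs (insert k K). F s)
      = (\<Sum>(y, s)\<in>{-1, 1} \<times> signs K. F (s(k := y)))"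
    unfolding signs_def PiE_insert_eq
    by (subst sum.reindex[OF inj_combinator[OF assms(2)]]) (simp add: case_prod_beta o_def)
  also have "\<dots> = (\<Sum>y\<in>{-1, 1}. \<Sum>s\<in>signs K. F (s(k := y)))"
    by (simp add: sum.cartesian_product)
  finally show ?thesis
    by (simp add: sum.distrib add.commute)
qed

text \<open>Flipping all signs is an involution of \<open>signs K\<close>; restricting to
  \<open>K\<close> keeps the flipped pattern extensional. In the symmetrization this symmetry merges
  the terms of the two copies into a factor 2.\<close>

lemma sum_signs_uminus:
  "(\<Sum>s\<in>signs K. F (\<lambda>k\<in>K. - s k)) = (\<Sum>s\<in>signs K. F s)"
  by (rule sum.reindex_bij_witness[where i = "\<lambda>s. \<lambda>k\<in>K. - s k" and j = "\<lambda>s. \<lambda>k\<in>K. - s k"])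
     (auto simp: signs_def PiE_iff restrict_def extensional_def fun_eq_iff)

text \<open>The two suprema on the left may be approached at different points \<open>t\<close> and
  \<open>t'\<close>, which contribute \<open>c t - c t' \<le> \<bar>a t - a t'\<bar>\<close>.
  Depending on the sign of \<open>a t - a t'\<close>, the two points are assigned to the suprema on
  the right in this order or swapped.\<close>

lemma cSUP_add_contraction:
  fixes a b c :: "'t \<Rightarrow> real"
  assumes "T \<noteq> {}" 
    and "bdd_above ((\<lambda>t. b t + a t) ` T)" "bdd_above ((\<lambda>t. b t - a t) ` T)"
    and "\<And>t t'. t \<in> T \<Longrightarrow> t' \<in> T \<Longrightarrow> \<bar>c t - c t'\<bar> \<le> \<bar>a t - a t'\<bar>"
  shows "(SUP t\<in>T. b t + c t) + (SUP t\<in>T. b t - c t) \<le> (SUP t\<in>T. b t + a t) + (SUP t\<in>T. b t - a t)"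
    (is "_ \<le> ?R")
proof -
  have *: "(b t + c t) + (b t' - c t') \<le> ?R" if "t \<in> T" "t' \<in> T" for t t'
  proof -
    have "b t + a t \<le> (SUP t\<in>T. b t + a t)" "b t' + a t' \<le> (SUP t\<in>T. b t + a t)"
      "b t - a t \<le> (SUP t\<in>T. b t - a t)" "b t' - a t' \<le> (SUP t\<in>T. b t - a t)"
      using assms(2,3) that by (auto intro: cSUP_upper)
    with assms(4)[OF that] show ?thesis by linarith
  qed
  have "(SUP t\<in>T. b t + c t) \<le> ?R - (b t' - c t')" if "t' \<in> T" for t'
    using assms(1) *[OF _ that] by (intro cSUP_least) (auto simp: algebra_simps)
  then have "(SUP t\<in>T. b t - c t) \<le> ?R - (SUP t\<in>T. b t + c t)"
    using assms(1) by (intro cSUP_least) (auto simp: algebra_simps)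
  then show ?thesis by simp
qed

text \<open>Induction over the coordinates. The offset \<open>b\<close> is arbitrary so that it can
  absorb a coordinate whose sign has been fixed; \<open>B\<close> and \<open>C\<close> keep all
  suprema bounded above.\<close>

lemma rademacher_contraction:
  fixes a c :: "'t \<Rightarrow> 'k \<Rightarrow> real"
  assumes "finite K" "T \<noteq> {}"
    and "\<And>t. t \<in> T \<Longrightarrow> \<bar>b t\<bar> \<le> B"
    and "\<And>t k. t \<in> T \<Longrightarrow> k \<in> K \<Longrightarrow> \<bar>a t k\<bar> \<le> C k"
    and "\<And>t k. t \<in> T \<Longrightarrow> k \<in> K \<Longrightarrow> \<bar>c t k\<bar> \<le> C k"
    and "\<And>t t' k. t \<in> T \<Longrightarrow> t' \<in> T \<Longrightarrow> k \<in> K \<Longrightarrow> \<bar>c t k - c t' k\<bar> \<le> \<bar>a t k - a t' k\<bar>"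
  shows "(\<Sum>s\<in>signs K. SUP t\<in>T. b t + (\<Sum>k\<in>K. s k * c t k))
    \<le> (\<Sum>s\<in>signs K. SUP t\<in>T. b t + (\<Sum>k\<in>K. s k * a t k))"
  using assms(1,3-)
proof (induction K arbitrary: b B rule: finite_induct)
  case (insert k K)
  have split: "(\<Sum>s\<in>signs (insert k K). SUP t\<in>T. b t + (\<Sum>k\<in>insert k K. s k * h t k))
      = (\<Sum>s\<in>signs K. (SUP t\<in>T. (b t + h t k) + (\<Sum>k\<in>K. s k * h t k))
          + (SUP t\<in>T. (b t - h t k) + (\<Sum>k\<in>K. s k * h t k)))" for h
  proof -
    have "(\<Sum>j\<in>K. (s(k := y)) j * h t j) = (\<Sum>j\<in>K. s j * h t j)" for s y t
      using insert.hyps by (intro sum.cong) auto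
    then show ?thesis
      by (subst sum_signs_insert) (use insert.hyps in \<open>simp_all add: algebra_simps\<close>)
  qed
  have bnd: "\<bar>b t + c t k\<bar> \<le> B + C k" "\<bar>b t - c t k\<bar> \<le> B + C k" 
      "\<bar>a t k\<bar> \<le> C k" "\<bar>b t\<bar> \<le> B" if "t \<in> T" for t
    using insert.prems(1)[OF that] insert.prems(3)[OF that, of k] insert.prems(2)[OF that, of k] by auto
  \<comment> \<open>The offset still contains \<open>c t k\<close> here, so the bound handed to the
    induction hypothesis grows to \<open>B + C k\<close>.\<close>
  have "(\<Sum>s\<in>signs K. (SUP t\<in>T. (b t + c t k) + (\<Sum>k\<in>K. s k * c t k))
          + (SUP t\<in>T. (b t - c t k) + (\<Sum>k\<in>K. s k * c t k)))
      \<le> (\<Sum>s\<in>signs K. (SUP t\<in>T. (b t + c t k) + (\<Sum>k\<in>K. s k * a t k))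
          + (SUP t\<in>T. (b t - c t k) + (\<Sum>k\<in>K. s k * a t k)))"
    unfolding sum.distrib
    by (intro add_mono insert.IH[where B = "B + C k"] bnd insert.prems) auto
  also have "\<dots> \<le> (\<Sum>s\<in>signs K. (SUP t\<in>T. (b t + a t k) + (\<Sum>k\<in>K. s k * a t k))
          + (SUP t\<in>T. (b t - a t k) + (\<Sum>k\<in>K. s k * a t k)))"
  \<comment> \<open>With the other signs fixed, their sum joins \<open>b\<close> as the common part
    of both suprema, and only coordinate \<open>k\<close> is contracted.\<close>
  proof (intro sum_mono)
    fix s assume s: "s \<in> signs K"
    have sum_le: "\<bar>\<Sum>k\<in>K. s k * a t k\<bar> \<le> (\<Sum>k\<in>K. C k)" if "t \<in> T" for t
    proof -
      have "\<bar>\<Sum>k\<in>K. s k * a t k\<bar> \<le> (\<Sum>k\<in>K. \<bar>s k * a t k\<bar>)"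
        by (rule sum_abs)
      also have "\<dots> \<le> (\<Sum>k\<in>K. C k)"
        using that insert.prems(2) s by (intro sum_mono) (simp add: abs_mult abs_signs)
      finally show ?thesis .
    qed
    then have "(b t + (\<Sum>k\<in>K. s k * a t k)) + a t k \<le> B + (\<Sum>k\<in>K. C k) + C k"
      "(b t + (\<Sum>k\<in>K. s k * a t k)) - a t k \<le> B + (\<Sum>k\<in>K. C k) + C k" if "t \<in> T" for t
      using bnd(3,4)[OF that] sum_le[OF that] by linarith+
    note bdd = this[THEN bdd_aboveI2]
    from cSUP_add_contraction[OF assms(2) bdd, where c = "\<lambda>t. c t k"] insert.prems(4)
    show "(SUP t\<in>T. (b t + c t k) + (\<Sum>k\<in>K. s k * a t k))
          + (SUP t\<in>T. (b t - c t k) + (\<Sum>k\<in>K. s k * a t k))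
        \<le> (SUP t\<in>T. (b t + a t k) + (\<Sum>k\<in>K. s k * a t k))
          + (SUP t\<in>T. (b t - a t k) + (\<Sum>k\<in>K. s k * a t k))"
      by (simp add: algebra_simps)
  qed
  finally show ?case
    unfolding split .
qed simp

section \<open>Duality of the norms\<close>

lemma one_divide_ennreal:
  assumes "0 \<le> r" "1 / ennreal r \<noteq> \<infinity>"
  shows "0 < r" "1 / ennreal r = ennreal (1 / r)"
proof -
  show "0 < r"
    using assms by (cases "r = 0") (auto simp: divide_ennreal_def)
  then show "1 / ennreal r = ennreal (1 / r)"
    using divide_ennreal[of 1 r] by simp
qed

text \<open>Since \<open>1 / 0 = \<infinity>\<close> in \<open>ennreal\<close>, the equation rules
  out zero exponents. At the endpoints one of the two norms is a maximum; in between, the equation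
  is transferred to real exponents above 1, where Young's inequality applies.\<close>

lemma conjugate_exponent_cases:
  fixes p q :: ennreal
  assumes "1 \<le> p" "1 / p + 1 / q = 1"
  obtains "p = \<infinity>" "q = 1" | "p = 1" "q = \<infinity>"
  | "p \<noteq> \<infinity>" "q \<noteq> \<infinity>" "enn2real p > 1" "enn2real q > 1"
    "1 / enn2real p + 1 / enn2real q = 1"
proof -
  have finite_div: "1 / p \<noteq> \<infinity>" "1 / q \<noteq> \<infinity>"
    using assms(2) by auto
  consider "p = \<infinity>" | "p \<noteq> \<infinity>" "q = \<infinity>" | "p \<noteq> \<infinity>" "q \<noteq> \<infinity>" by blast
  then show ?thesis
  proof cases
    case 1
    with assms(2) have "1 / q = 1" by simp
    moreover from this have "q \<noteq> \<infinity>" by auto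
    then obtain Q where Q: "q = ennreal Q" "Q \<ge> 0" by (cases q) auto
    ultimately have "q = 1" using one_divide_ennreal[OF Q(2)] finite_div(2) by simp
    with 1 that(1) show ?thesis by blast
  next
    case 2
    with assms(2) have "1 / p = 1" by simp
    moreover obtain P where P: "p = ennreal P" "P \<ge> 0" using 2 by (cases p) auto
    ultimately have "p = 1" using one_divide_ennreal[OF P(2)] finite_div(1) by simp
    with 2 that(2) show ?thesis by blast
  next
    case 3
    then obtain P Q where P: "p = ennreal P" "P \<ge> 0" and Q: "q = ennreal Q" "Q \<ge> 0"
      by (cases p; cases q) auto
    note dP = one_divide_ennreal[OF P(2) finite_div(1)[unfolded P(1)]]
    note dQ = one_divide_ennreal[OF Q(2) finite_div(2)[unfolded Q(1)]]
    have "ennreal (1 / P + 1 / Q) = 1"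
      using assms(2) dP dQ unfolding P(1) Q(1) by (subst ennreal_plus) auto
    then have PQ: "1 / P + 1 / Q = 1" by (simp only: ennreal_eq_1)
    have "0 < 1 / P" "0 < 1 / Q" using dP dQ by simp_all
    with PQ have "1 / P < 1" "1 / Q < 1" by linarith+
    then have "P > 1" "Q > 1" using dP(1) dQ(1) by simp_all
    with that(3) 3 P Q PQ show ?thesis by simp
  qed
qed

lemma lp_norm_top: "lp_norm top_class.top x = Max ((\<lambda>i. \<bar>x $ i\<bar>) ` {..<dim_vec x})"
  by (simp add: lp_norm_def)

lemma lp_norm_1: "lp_norm 1 x = (\<Sum>i<dim_vec x. \<bar>x $ i\<bar>)"
  by (simp add: lp_norm_def sum_nonneg)

lemma abs_le_lp_norm_top: "i < dim_vec x \<Longrightarrow> \<bar>x $ i\<bar> \<le> lp_norm top_class.top x"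
  unfolding lp_norm_top by (rule Max_ge) auto

lemma lp_norm_nonneg: "0 < dim_vec x \<Longrightarrow> 0 \<le> lp_norm p x"
  using abs_le_lp_norm_top[of 0 x] by (cases "p = top_class.top") (auto simp: lp_norm_def[of p])

text \<open>Hoelder's inequality against a unit vector. Away from the endpoints, Young's inequality
  bounds the pairing of two normalized vectors by \<open>1 / P + 1 / Q = 1\<close>.\<close>

lemma holder_lp_norm:
  assumes "1 \<le> p" "1 / p + 1 / q = 1" "x \<in> carrier_vec m" "u \<in> carrier_vec m" "lp_norm q u = 1"
  shows "(\<Sum>j<m. x $ j * u $ j) \<le> lp_norm p x"
proof -
  have dims [simp]: "dim_vec x = m" "dim_vec u = m" using assms(3,4) by auto
  have "(\<Sum>j<m. x $ j * u $ j) \<le> (\<Sum>j<m. \<bar>x $ j\<bar> * \<bar>u $ j\<bar>)"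
    by (intro sum_mono) (metis abs_ge_self abs_mult)
  also have "\<dots> \<le> lp_norm p x"
    using assms(1,2)
  proof (cases rule: conjugate_exponent_cases)
    case 1
    have "(\<Sum>j<m. \<bar>x $ j\<bar> * \<bar>u $ j\<bar>) \<le> (\<Sum>j<m. lp_norm top_class.top x * \<bar>u $ j\<bar>)"
      by (intro sum_mono mult_right_mono) (auto simp: abs_le_lp_norm_top)
    also have "\<dots> = lp_norm top_class.top x"
      using assms(5) 1 by (simp add: lp_norm_1 flip: sum_distrib_left)
    finally show ?thesis using 1 by simp
  next
    case 2
    have "(\<Sum>j<m. \<bar>x $ j\<bar> * \<bar>u $ j\<bar>) \<le> (\<Sum>j<m. \<bar>x $ j\<bar> * 1)"
      using assms(5) 2 abs_le_lp_norm_top[of _ u] by (intro sum_mono mult_left_mono) auto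
    then show ?thesis using 2 by (simp add: lp_norm_1)
  next
    case 3
    define P Q where "P = enn2real p" and "Q = enn2real q"
    have PQ: "P > 1" "Q > 1" "1 / P + 1 / Q = 1" using 3 by (auto simp: P_def Q_def)
    have "(\<Sum>j<m. \<bar>u $ j\<bar> powr Q) powr (1 / Q) = 1"
      using assms(5) 3 by (simp add: lp_norm_def Q_def)
    then have "((\<Sum>j<m. \<bar>u $ j\<bar> powr Q) powr (1 / Q)) powr Q = 1" by simp
    then have u: "(\<Sum>j<m. \<bar>u $ j\<bar> powr Q) = 1"
      using PQ by (simp add: powr_powr sum_nonneg)
    let ?S = "\<Sum>j<m. \<bar>x $ j\<bar> powr P"
    define N where "N = ?S powr (1 / P)"
    have N: "N = lp_norm p x" "N \<ge> 0" using 3 by (simp_all add: N_def lp_norm_def P_def)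
    have NP: "N powr P = ?S" using PQ by (simp add: N_def powr_powr sum_nonneg)
    show ?thesis
    \<comment> \<open>Normalizing \<open>x\<close> divides by its norm \<open>N\<close>; if
      \<open>N\<close> vanishes, so does every entry of \<open>x\<close>.\<close>
    proof (cases "N = 0")
      case True
      then have "?S = 0" using NP PQ by simp
      then have "x $ j = 0" if "j < m" for j
        using that by (subst (asm) sum_nonneg_eq_0_iff) auto
      then show ?thesis using N by simp
    next
      case False
      with N(2) have "N > 0" by simp
      have "(\<Sum>j<m. \<bar>x $ j\<bar> / N * \<bar>u $ j\<bar>) 
          \<le> (\<Sum>j<m. (\<bar>x $ j\<bar> / N) powr P / P + \<bar>u $ j\<bar> powr Q / Q)"
        using PQ N(2) by (intro sum_mono Youngs_inequality) auto
      also have "\<dots> = (\<Sum>j<m. \<bar>x $ j\<bar> powr P / N powr P / P) + 1 / Q"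
        using N(2) by (simp add: sum.distrib powr_divide u flip: sum_divide_distrib)
      also have "(\<Sum>j<m. \<bar>x $ j\<bar> powr P / N powr P / P) = 1 / P"
        using \<open>N > 0\<close> by (simp flip: sum_divide_distrib NP)
      finally have "(\<Sum>j<m. \<bar>x $ j\<bar> * \<bar>u $ j\<bar>) / N \<le> 1"
        using PQ by (simp add: sum_divide_distrib)
      then show ?thesis using \<open>N > 0\<close> N(1) by (simp add: divide_simps)
    qed
  qed
  finally show ?thesis .
qed

text \<open>The vectors \<open>u\<close> are the equality cases of Hoelder's inequality, one
  construction for each regime of exponents.\<close>

lemma lp_norm_attained:
  assumes "1 \<le> p" "1 / p + 1 / q = 1" "x \<in> carrier_vec m" "1 \<le> m"
  obtains u where "u \<in> carrier_vec m" "lp_norm q u = 1" "(\<Sum>j<m. x $ j * u $ j) = lp_norm p x"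
proof -
  have dims [simp]: "dim_vec x = m" using assms(3) by auto
  have "m > 0" using assms(4) by simp
  show ?thesis
    using assms(1,2)
  proof (cases rule: conjugate_exponent_cases)
    case 1
    have "lp_norm top_class.top x \<in> (\<lambda>i. \<bar>x $ i\<bar>) ` {..<m}"
      unfolding lp_norm_top dims using \<open>m > 0\<close> by (intro Max_in) auto
    then obtain i where i: "i < m" "lp_norm top_class.top x = \<bar>x $ i\<bar>" by auto
    \<comment> \<open>All mass sits at a largest entry, with the sign of that entry. Sign 1 for a
      zero entry keeps \<open>u\<close> on the sphere even when \<open>x\<close> is zero.\<close>
    define u where "u = vec m (\<lambda>j. if j = i then (if x $ i < 0 then -1 else 1) else 0 :: real)"
    have "lp_norm 1 u = (\<Sum>j<m. if j = i then 1 else 0)"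
      unfolding lp_norm_1 by (intro sum.cong) (auto simp: u_def)
    moreover have "(\<Sum>j<m. x $ j * u $ j) = (\<Sum>j<m. if j = i then \<bar>x $ i\<bar> else 0)"
      by (intro sum.cong) (auto simp: u_def)
    ultimately show ?thesis
      using i 1 by (intro that[of u]) (auto simp: u_def)
  next
    case 2
    \<comment> \<open>Unlike \<open>sgn\<close>, this gives modulus 1 also where \<open>x\<close>
      vanishes, so the maximum norm is 1 for every \<open>x\<close>.\<close>
    define u where "u = vec m (\<lambda>j. if x $ j < 0 then -1 else 1 :: real)"
    have "(\<lambda>i. \<bar>u $ i\<bar>) ` {..<m} = {1}"
      using \<open>m > 0\<close> by (force simp: u_def)
    then have "lp_norm top_class.top u = 1"
      unfolding lp_norm_top by (simp add: u_def)
    moreover have "(\<Sum>j<m. x $ j * u $ j) = (\<Sum>j<m. \<bar>x $ j\<bar>)"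
      by (intro sum.cong) (auto simp: u_def)
    ultimately show ?thesis
      using 2 by (intro that[of u]) (auto simp: u_def lp_norm_1)
  next
    case 3
    define P Q where "P = enn2real p" and "Q = enn2real q"
    have PQ: "P > 1" "Q > 1" "1 / P + 1 / Q = 1" using 3 by (auto simp: P_def Q_def)
    have lpq: "lp_norm q u = (\<Sum>j<dim_vec u. \<bar>u $ j\<bar> powr Q) powr (1 / Q)" for u
      using 3 by (simp add: lp_norm_def Q_def)
    let ?S = "\<Sum>j<m. \<bar>x $ j\<bar> powr P"
    define N where "N = ?S powr (1 / P)"
    have N: "N = lp_norm p x" "N \<ge> 0" using 3 by (simp_all add: N_def lp_norm_def P_def)
    have NP: "N powr P = ?S" using PQ by (simp add: N_def powr_powr sum_nonneg)
    show ?thesis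
    proof (cases "N = 0")
      case True
      then have "?S = 0" using NP PQ by simp
      then have x0: "x $ j = 0" if "j < m" for j
        using that by (subst (asm) sum_nonneg_eq_0_iff) auto
      define u where "u = vec m (\<lambda>j. if j = 0 then 1 else 0 :: real)"
      have "(\<Sum>j<m. \<bar>u $ j\<bar> powr Q) = (\<Sum>j<m. if j = 0 then 1 else 0)"
        by (intro sum.cong) (auto simp: u_def)
      then have "lp_norm q u = 1"
        unfolding lpq using \<open>m > 0\<close> by (simp add: u_def)
      then show ?thesis
        using x0 N True by (intro that[of u]) (auto simp: u_def)
    next
      case False
      with N(2) have "N > 0" by simp
      \<comment> \<open>Equality in Young's inequality forces
        \<open>\<bar>u $ j\<bar> powr Q = (\<bar>x $ j\<bar> / N) powr P\<close>, that is, the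
        exponent \<open>P / Q = P - 1\<close>.\<close>
      define u where "u = vec m (\<lambda>j. sgn (x $ j) * (\<bar>x $ j\<bar> / N) powr (P - 1))"
      have PQ': "(P - 1) * Q = P"
        using PQ by (simp add: field_simps)
      have "(\<Sum>j<m. \<bar>u $ j\<bar> powr Q) = (\<Sum>j<m. \<bar>x $ j\<bar> powr P / N powr P)"
      proof (intro sum.cong refl)
        fix j assume "j \<in> {..<m}"
        then have "\<bar>u $ j\<bar> = (\<bar>x $ j\<bar> / N) powr (P - 1)"
          using PQ by (auto simp: u_def abs_mult sgn_if)
        then show "\<bar>u $ j\<bar> powr Q = \<bar>x $ j\<bar> powr P / N powr P"
          using N(2) PQ' by (simp add: powr_powr powr_divide)
      qed
      also have "\<dots> = 1"
        using \<open>N > 0\<close> by (simp flip: sum_divide_distrib NP)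
      finally have "lp_norm q u = 1"
        unfolding lpq by (simp add: u_def)
      moreover have "(\<Sum>j<m. x $ j * u $ j) = (\<Sum>j<m. N * (\<bar>x $ j\<bar> powr P / N powr P))"
      proof (intro sum.cong refl)
        fix j assume "j \<in> {..<m}"
        moreover have "x $ j * sgn (x $ j) = \<bar>x $ j\<bar>"
          by (simp add: sgn_if)
        ultimately have "x $ j * u $ j = \<bar>x $ j\<bar> * (\<bar>x $ j\<bar> / N) powr (P - 1)"
          by (simp add: u_def flip: mult.assoc)
        \<comment> \<open>Exposing a power 1 lets \<open>powr_add\<close> join it to the power
          \<open>P - 1\<close>. Zero entries are covered, because \<open>0 powr a = 0\<close> for
          every \<open>a\<close>.\<close>
        also have "\<dots> = N * ((\<bar>x $ j\<bar> / N) powr 1 * (\<bar>x $ j\<bar> / N) powr (P - 1))"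
          using \<open>N > 0\<close> by simp
        also have "\<dots> = N * (\<bar>x $ j\<bar> powr P / N powr P)"
          using \<open>N > 0\<close> by (subst powr_add[symmetric]) (simp add: powr_divide)
        finally show "x $ j * u $ j = N * (\<bar>x $ j\<bar> powr P / N powr P)" .
      qed
      then have "(\<Sum>j<m. x $ j * u $ j) = N"
        using \<open>N > 0\<close> by (simp flip: sum_divide_distrib sum_distrib_left NP)
      ultimately show ?thesis
        using N(1) by (intro that[of u]) (auto simp: u_def)
    qed
  qed
qed

text \<open>On the unit sphere this bounds every coordinate by 1. All domination by sums of
  \<open>\<bar>Z \<omega> $$ (j, k)\<bar>\<close> rests on that.\<close>

lemma abs_le_lp_norm:
  assumes "1 \<le> q" "j < dim_vec u"
  shows "\<bar>u $ j\<bar> \<le> lp_norm q u"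
proof (cases "q = \<infinity>")
  case False
  with assms(1) have Q: "enn2real q \<ge> 1"
    by (cases q) auto
  have "\<bar>u $ j\<bar> = (\<bar>u $ j\<bar> powr enn2real q) powr (1 / enn2real q)"
    using Q by (simp add: powr_powr)
  also have "\<dots> \<le> lp_norm q u"
    unfolding lp_norm_def using False Q assms(2)
    by (auto intro!: powr_mono2 member_le_sum)
  finally show ?thesis .
qed (use assms abs_le_lp_norm_top in simp)

lemma conjugate_exponent_ge_1:
  fixes p q :: ennreal
  assumes "1 / p + 1 / q = 1"
  shows "1 \<le> q"
proof (cases "q = \<infinity>")
  case False
  then obtain Q where Q: "q = ennreal Q" "Q \<ge> 0" by (cases q) auto
  have "1 / q \<le> 1 / p + 1 / q" by simp
  with assms have le: "1 / q \<le> 1" by simp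
  then have "1 / q \<noteq> \<infinity>" by (auto simp: top_unique)
  from one_divide_ennreal[OF Q(2) this[unfolded Q(1)]] le Q have "0 < Q" "1 / Q \<le> 1"
    by (simp_all add: ennreal_le_1)
  then show ?thesis using Q by simp
qed simp

text \<open>The dual unit vector has entries of modulus at most 1. The sum on the right serves as an
  integrable majorant, uniformly in \<open>p\<close>.\<close>

lemma lp_norm_le_sum:
  assumes "1 \<le> p" "1 / p + 1 / q = 1" "x \<in> carrier_vec m" "1 \<le> m"
  shows "lp_norm p x \<le> (\<Sum>j<m. \<bar>x $ j\<bar>)"
proof -
  obtain u where u: "u \<in> carrier_vec m" "lp_norm q u = 1" "(\<Sum>j<m. x $ j * u $ j) = lp_norm p x"
    using lp_norm_attained[OF assms] .
  have "(\<Sum>j<m. x $ j * u $ j) \<le> (\<Sum>j<m. \<bar>x $ j\<bar> * \<bar>u $ j\<bar>)"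
    by (intro sum_mono) (metis abs_ge_self abs_mult)
  also have "\<dots> \<le> (\<Sum>j<m. \<bar>x $ j\<bar> * 1)"
    using abs_le_lp_norm[OF conjugate_exponent_ge_1[OF assms(2)], of _ u] u(1,2)
    by (intro sum_mono mult_left_mono) auto
  finally show ?thesis using u(3) by simp
qed

text \<open>Vectors carry no sigma-algebra, so measurability of the norm is phrased through the
  coordinate functions.\<close>

lemma borel_measurable_lp_norm_vec:
  assumes "\<And>j. j < m \<Longrightarrow> g j \<in> borel_measurable N"
  shows "(\<lambda>\<omega>. lp_norm p (vec m (\<lambda>j. g j \<omega>))) \<in> borel_measurable N"
proof (cases "p = \<infinity>")
  case True
  have "(\<lambda>\<omega>. Max ((\<lambda>j. \<bar>g j \<omega>\<bar>) ` {..<m})) \<in> borel_measurable N"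
    using assms by (intro borel_measurable_Max) auto
  moreover have "lp_norm p (vec m (\<lambda>j. g j \<omega>)) = Max ((\<lambda>j. \<bar>g j \<omega>\<bar>) ` {..<m})" for \<omega>
    unfolding True infinity_ennreal_def lp_norm_top by (intro arg_cong[where f = Max] image_cong) auto
  ultimately show ?thesis
    by simp
next
  case False
  have "(\<lambda>\<omega>. (\<Sum>j<m. \<bar>g j \<omega>\<bar> powr enn2real p) powr (1 / enn2real p)) \<in> borel_measurable N"
    using assms by (intro powr_real_measurable borel_measurable_sum borel_measurable_abs borel_measurable_const) auto
  with False show ?thesis
    by (simp add: lp_norm_def)
qed

section \<open>Symmetrization\<close>

text \<open>Jensen's inequality without conditional expectations: pointwise
  \<open>\<bar>x\<bar> + sgn x * y \<le> \<bar>x + y\<bar>\<close>, and by independence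
  \<open>sgn (X \<omega>) * Y \<omega>\<close> has mean zero.\<close>

lemma (in prob_space) expectation_abs_le_add_indep:
  fixes X Y :: "'a \<Rightarrow> real"
  assumes "indep_var borel X borel Y" "integrable M X" "integrable M Y" "expectation Y = 0"
  shows "expectation (\<lambda>\<omega>. \<bar>X \<omega>\<bar>) \<le> expectation (\<lambda>\<omega>. \<bar>X \<omega> + Y \<omega>\<bar>)"
proof -
  have meas [measurable]: "X \<in> borel_measurable M" "Y \<in> borel_measurable M"
    using assms(2,3) by auto
  have "indep_var borel ((\<lambda>x. sgn x) \<circ> X) borel ((\<lambda>y. y) \<circ> Y)"
    by (rule indep_var_compose[OF assms(1)]) auto
  then have ind: "indep_var borel (\<lambda>\<omega>. sgn (X \<omega>)) borel Y"
    by (simp add: o_def)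
  have int_sgn: "integrable M (\<lambda>\<omega>. sgn (X \<omega>))"
    by (rule integrable_const_bound[where B = 1]) (auto simp: abs_sgn_eq)
  have "expectation (\<lambda>\<omega>. \<bar>X \<omega>\<bar>) = expectation (\<lambda>\<omega>. \<bar>X \<omega>\<bar> + sgn (X \<omega>) * Y \<omega>)"
    using assms indep_var_lebesgue_integral[OF ind int_sgn] indep_var_integrable[OF ind int_sgn]
    by simp
  also have "\<dots> \<le> expectation (\<lambda>\<omega>. \<bar>X \<omega> + Y \<omega>\<bar>)"
    using assms indep_var_integrable[OF ind int_sgn]
  proof (intro integral_mono)
    show "\<bar>X \<omega>\<bar> + sgn (X \<omega>) * Y \<omega> \<le> \<bar>X \<omega> + Y \<omega>\<bar>" for \<omega>
      by (auto simp: sgn_if abs_if)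
  qed auto
  finally show ?thesis .
qed

lemma (in prob_space) indep_var_sums:
  fixes X :: "'i \<Rightarrow> 'a \<Rightarrow> real"
  assumes "finite J" "indep_vars (\<lambda>_. borel) X J" "A \<subseteq> J" "B \<subseteq> J" "A \<inter> B = {}"
  shows "indep_var borel (\<lambda>\<omega>. \<Sum>j\<in>A. X j \<omega>) borel (\<lambda>\<omega>. \<Sum>j\<in>B. - X j \<omega>)"
proof -
  have "indep_var
    borel ((\<lambda>x. \<Sum>j\<in>A. x j) \<circ> (\<lambda>\<omega>. restrict (\<lambda>j. X j \<omega>) A))
    borel ((\<lambda>x. \<Sum>j\<in>B. - x j) \<circ> (\<lambda>\<omega>. restrict (\<lambda>j. X j \<omega>) B))"
    by (intro indep_var_compose[OF indep_var_restrict[OF assms(2) assms(5,3,4)]]) auto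
  then show ?thesis by (simp add: o_def cong: sum.cong)
qed

text \<open>Split the sum at the two signs: by Jensen, centering lets each half be completed by the other
  half with the opposite sign.\<close>
lemma (in prob_space) expectation_abs_sum_le_signed:
  fixes X :: "'i \<Rightarrow> 'a \<Rightarrow> real"
  assumes "finite J" "indep_vars (\<lambda>_. borel) X J"
    and "\<And>j. j \<in> J \<Longrightarrow> integrable M (X j)" "\<And>j. j \<in> J \<Longrightarrow> expectation (X j) = 0"
    and "\<And>j. j \<in> J \<Longrightarrow> \<bar>s j\<bar> = 1"
  shows "expectation (\<lambda>\<omega>. \<bar>\<Sum>j\<in>J. X j \<omega>\<bar>) \<le> 2 * expectation (\<lambda>\<omega>. \<bar>\<Sum>j\<in>J. s j * X j \<omega>\<bar>)"
proof -
  define A where "A = {j \<in> J. s j = 1}"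
  define B where "B = {j \<in> J. s j = -1}"
  have "s j = 1 \<or> s j = -1" if "j \<in> J" for j
    using assms(5)[OF that] by (auto simp: abs_if split: if_splits)
  then have J: "J = A \<union> B" "A \<inter> B = {}"
    by (auto simp: A_def B_def)
  have sub: "A \<subseteq> J" "B \<subseteq> J" and fin: "finite A" "finite B"
    using assms(1) J by auto
  have [simp]: "integrable M (X j)" "expectation (X j) = 0" if "j \<in> A \<or> j \<in> B" for j
    using that J assms(3,4) by auto
  have signed: "(\<Sum>j\<in>J. s j * X j \<omega>) = (\<Sum>j\<in>A. X j \<omega>) - (\<Sum>j\<in>B. X j \<omega>)" for \<omega>
  proof -
    have "(\<Sum>j\<in>J. s j * X j \<omega>) = (\<Sum>j\<in>A. s j * X j \<omega>) + (\<Sum>j\<in>B. s j * X j \<omega>)"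
      using J fin by (simp add: sum.union_disjoint)
    also have "\<dots> = (\<Sum>j\<in>A. X j \<omega>) + (\<Sum>j\<in>B. - X j \<omega>)"
      by (intro arg_cong2[where f = "(+)"] sum.cong) (auto simp: A_def B_def)
    finally show ?thesis by (simp add: sum_negf)
  qed
  have half: "expectation (\<lambda>\<omega>. \<bar>\<Sum>j\<in>C. X j \<omega>\<bar>)
      \<le> expectation (\<lambda>\<omega>. \<bar>(\<Sum>j\<in>C. X j \<omega>) - (\<Sum>j\<in>D. X j \<omega>)\<bar>)"
    if "C = A \<and> D = B \<or> C = B \<and> D = A" for C D
  proof -
    have CD: "C \<subseteq> J" "D \<subseteq> J" "C \<inter> D = {}" "\<And>j. j \<in> C \<Longrightarrow> j \<in> A \<or> j \<in> B"
        "\<And>j. j \<in> D \<Longrightarrow> j \<in> A \<or> j \<in> B"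
      using that sub J(2) by auto
    from expectation_abs_le_add_indep[OF indep_var_sums[OF assms(1,2) CD(1,2,3)]] CD
    show ?thesis by (simp add: sum_negf Bochner_Integration.integral_sum)
  qed
  have "expectation (\<lambda>\<omega>. \<bar>\<Sum>j\<in>J. X j \<omega>\<bar>)
      \<le> expectation (\<lambda>\<omega>. \<bar>\<Sum>j\<in>A. X j \<omega>\<bar> + \<bar>\<Sum>j\<in>B. X j \<omega>\<bar>)"
    using J fin by (intro integral_mono) (auto simp: sum.union_disjoint intro!: Bochner_Integration.integrable_sum integrable_abs Bochner_Integration.integrable_add)
  also have "\<dots> = expectation (\<lambda>\<omega>. \<bar>\<Sum>j\<in>A. X j \<omega>\<bar>) + expectation (\<lambda>\<omega>. \<bar>\<Sum>j\<in>B. X j \<omega>\<bar>)"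
    by (intro Bochner_Integration.integral_add) auto
  \<comment> \<open>Each half is bounded by one whole signed sum, which is the origin of the factor
    2.\<close>
  also have "\<dots> \<le> 2 * expectation (\<lambda>\<omega>. \<bar>\<Sum>j\<in>J. s j * X j \<omega>\<bar>)"
    unfolding signed using half[of A B] half[of B A] by (simp add: abs_minus_commute)
  finally show ?thesis .
qed

section \<open>Integrating out an independent Rademacher vector\<close>

lemma (in prob_space) indep_set_borel_measurableI:
  assumes "indep_set (sets F) (sets H)" "space F = space M" "space H = space M"
    and "X \<in> borel_measurable F" "Y \<in> borel_measurable H"
  shows "indep_var borel X borel Y"
proof -
  have sub: "sets F \<subseteq> events" "sets H \<subseteq> events"
    using assms(1) by (auto simp: indep_sets2_eq)
  have "random_variable borel X" "random_variable borel Y"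
    using assms sub by (auto simp: measurable_def)
  moreover have "indep_set (sigma_sets (space M) {X -` A \<inter> space M | A. A \<in> sets borel})
      (sigma_sets (space M) {Y -` A \<inter> space M | A. A \<in> sets borel})"
    unfolding indep_set_def
  proof (rule indep_sets_mono_sets[OF assms(1)[unfolded indep_set_def]])
    have "sigma_sets (space M) {X -` A \<inter> space M | A. A \<in> sets borel} \<subseteq> sets F"
      using assms(2,4) by (subst assms(2)[symmetric], intro sets.sigma_sets_subset) (auto simp: measurable_def)
    moreover have "sigma_sets (space M) {Y -` A \<inter> space M | A. A \<in> sets borel} \<subseteq> sets H"
      using assms(3,5) by (subst assms(3)[symmetric], intro sets.sigma_sets_subset) (auto simp: measurable_def)
    ultimately show "case_bool (sigma_sets (space M) {X -` A \<inter> space M | A. A \<in> sets borel})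
      (sigma_sets (space M) {Y -` A \<inter> space M | A. A \<in> sets borel}) b \<subseteq> case_bool (sets F) (sets H) b" for b
      by (cases b) auto
  qed
  ultimately show ?thesis by (simp add: indep_var_eq)
qed

text \<open>Conditioning on a finite partition, written as
  \<open>X = (\<Sum>i\<in>I. indicator (G i) * h i)\<close> almost surely; independence of the two
  sigma-algebras factors each summand. The events need to cover the space only up to a null set, as
  Rademacher components are \<open>\<plusminus>1\<close> only almost surely.\<close>

lemma (in prob_space) expectation_mixture:
  fixes X :: "'a \<Rightarrow> real" and h :: "'i \<Rightarrow> 'a \<Rightarrow> real"
  assumes "indep_set (sets F) (sets H)" "space F = space M" "space H = space M"
    and "finite I" "\<And>i. i \<in> I \<Longrightarrow> G i \<in> sets F" "disjoint_family_on G I" "(\<Sum>i\<in>I. prob (G i)) = 1"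
    and "\<And>i. i \<in> I \<Longrightarrow> h i \<in> borel_measurable H" "\<And>i. i \<in> I \<Longrightarrow> integrable M (h i)"
    and "X \<in> borel_measurable M" "\<And>i \<omega>. i \<in> I \<Longrightarrow> \<omega> \<in> G i \<Longrightarrow> X \<omega> = h i \<omega>"
  shows "expectation X = (\<Sum>i\<in>I. prob (G i) * expectation (h i))"
proof -
  have G [simp]: "G i \<in> events" if "i \<in> I" for i
    using assms(1,5) that by (auto simp: indep_sets2_eq)
  have ind: "indep_var borel (indicator (G i) :: 'a \<Rightarrow> real) borel (h i)" if "i \<in> I" for i
    using assms(5,8) that by (intro indep_set_borel_measurableI[OF assms(1-3)]) auto
  have intG: "integrable M (indicator (G i) :: 'a \<Rightarrow> real)" if "i \<in> I" for i
    using that by (simp add: emeasure_eq_measure)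
  have "prob (\<Union>i\<in>I. G i) = 1"
    using assms(4,6,7) by (subst finite_measure_finite_Union) auto
  then have "AE \<omega> in M. \<omega> \<in> (\<Union>i\<in>I. G i)"
    using assms(4) by (subst (asm) prob_eq_1) auto
  then have "AE \<omega> in M. X \<omega> = (\<Sum>i\<in>I. indicator (G i) \<omega> * h i \<omega>)"
  proof eventually_elim
    case (elim \<omega>)
    then obtain i where i: "i \<in> I" "\<omega> \<in> G i" by auto
    have "(\<Sum>i\<in>I. indicator (G i) \<omega> * h i \<omega>) = (\<Sum>j\<in>I. if j = i then h i \<omega> else 0)"
    proof (rule sum.cong)
      fix j assume "j \<in> I"
      then show "indicator (G j) \<omega> * h j \<omega> = (if j = i then h i \<omega> else 0)"
        using i assms(6) by (auto simp: disjoint_family_on_def indicator_def)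
    qed simp
    then show ?case using i assms(4,11) by simp
  qed
  then have "expectation X = expectation (\<lambda>\<omega>. \<Sum>i\<in>I. indicator (G i) \<omega> * h i \<omega>)"
  proof (intro integral_cong_AE)
    show "(\<lambda>\<omega>. \<Sum>i\<in>I. indicator (G i) \<omega> * h i \<omega>) \<in> borel_measurable M"
      using assms(9) by (intro borel_measurable_sum borel_measurable_times borel_measurable_indicator) auto
  qed (use assms(10) in auto)
  also have "\<dots> = (\<Sum>i\<in>I. expectation (\<lambda>\<omega>. indicator (G i) \<omega> * h i \<omega>))"
    using ind intG assms(9) by (intro Bochner_Integration.integral_sum indep_var_integrable) auto
  also have "\<dots> = (\<Sum>i\<in>I. prob (G i) * expectation (h i))"
    using ind intG assms(9) by (intro sum.cong) (auto simp: indep_var_lebesgue_integral)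
  finally show ?thesis .
qed

text \<open>The \<open>2 ^ card J\<close> patterns are equally likely and independent of the matrix.
  The index set \<open>J\<close> is free because the two sides of the matrix use different initial
  segments of the same vector, of lengths \<open>m\<close> and \<open>n\<close>. Measurability of
  \<open>h s\<close> refers to the sigma-algebra generated by the matrix, since that is what
  independence speaks about.\<close>

lemma (in prob_space) expectation_rademacher_average:
  fixes h :: "(nat \<Rightarrow> real) \<Rightarrow> 'a \<Rightarrow> real"
  assumes rad: "rademacher_vector d \<epsilon>" and ind: "indep_vec_mat d m n \<epsilon> Z"
    and J: "J \<subseteq> {..<d}" "J \<noteq> {}"
    and h: "\<And>s. s \<in> signs J \<Longrightarrow> h s \<in> borel_measurable (vimage_algebra (space M)
          (\<lambda>\<omega>. \<lambda>jk\<in>{..<m} \<times> {..<n}. Z \<omega> $$ jk) (PiM ({..<m} \<times> {..<n}) (\<lambda>_. borel)))"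
      "\<And>s. s \<in> signs J \<Longrightarrow> integrable M (h s)"
    and X: "X \<in> borel_measurable M"
      "\<And>s \<omega>. s \<in> signs J \<Longrightarrow> \<omega> \<in> space M \<Longrightarrow> (\<And>j. j \<in> J \<Longrightarrow> \<epsilon> \<omega> $ j = s j) \<Longrightarrow> X \<omega> = h s \<omega>"
  shows "expectation X = (\<Sum>s\<in>signs J. expectation (h s)) / 2 ^ card J"
proof -
  have finJ: "finite J" using J(1) finite_subset by auto
  let ?e = "\<lambda>\<omega>. \<lambda>i\<in>{..<d}. \<epsilon> \<omega> $ i"
  let ?F = "vimage_algebra (space M) ?e (PiM {..<d} (\<lambda>_. borel :: real measure))"
  define G where "G s = {\<omega> \<in> space M. \<forall>j\<in>J. \<epsilon> \<omega> $ j = s j}" for s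
  have eps: "indep_vars (\<lambda>_. borel) (\<lambda>i \<omega>. \<epsilon> \<omega> $ i) {..<d}"
    and half: "\<And>i. i < d \<Longrightarrow> prob {\<omega> \<in> space M. \<epsilon> \<omega> $ i = 1} = 1 / 2"
      "\<And>i. i < d \<Longrightarrow> prob {\<omega> \<in> space M. \<epsilon> \<omega> $ i = -1} = 1 / 2"
    using rad by (auto simp: rademacher_vector_def)
  have GF: "G s \<in> sets ?F" for s
  proof -
    have "{x \<in> space (PiM {..<d} (\<lambda>_. borel :: real measure)). \<forall>j\<in>J. x j = s j}
        \<in> sets (PiM {..<d} (\<lambda>_. borel))"
    proof (intro sets.sets_Collect_finite_All' finJ J(2))
      fix j assume "j \<in> J"
      then have [measurable]: "(\<lambda>x. x j) \<in> borel_measurable (PiM {..<d} (\<lambda>_. borel :: real measure))"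
        using J(1) by (intro measurable_component_singleton) auto
      show "{x \<in> space (PiM {..<d} (\<lambda>_. borel :: real measure)). x j = s j} \<in> sets (PiM {..<d} (\<lambda>_. borel))"
        by measurable
    qed
    moreover have "G s = ?e -` {x \<in> space (PiM {..<d} (\<lambda>_. borel :: real measure)). \<forall>j\<in>J. x j = s j} \<inter> space M"
      using J(1) by (auto simp: G_def space_PiM)
    ultimately show ?thesis by (simp only: in_vimage_algebra)
  qed
  have prG: "prob (G s) = (1 / 2) ^ card J" if "s \<in> signs J" for s
  proof -
    have "G s = (\<Inter>j\<in>J. (\<lambda>\<omega>. \<epsilon> \<omega> $ j) -` {s j} \<inter> space M)"
      using J(2) by (auto simp: G_def)
    also have "prob \<dots> = (\<Prod>j\<in>J. prob ((\<lambda>\<omega>. \<epsilon> \<omega> $ j) -` {s j} \<inter> space M))"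
      using indep_vars_subset[OF eps J(1)] J(2) finJ by (intro indep_varsD_finite) auto
    also have "\<dots> = (\<Prod>j\<in>J. 1 / 2)"
    proof (rule prod.cong[OF refl])
      fix j assume j: "j \<in> J"
      have "(\<lambda>\<omega>. \<epsilon> \<omega> $ j) -` {s j} \<inter> space M = {\<omega> \<in> space M. \<epsilon> \<omega> $ j = s j}" by auto
      moreover have "s j = 1 \<or> s j = -1" using that j by (auto simp: signs_def dest: PiE_mem)
      ultimately show "prob ((\<lambda>\<omega>. \<epsilon> \<omega> $ j) -` {s j} \<inter> space M) = 1 / 2"
        using half[of j] j J(1) by auto
    qed
    finally show ?thesis by simp
  qed
  have "expectation X = (\<Sum>s\<in>signs J. prob (G s) * expectation (h s))"
  proof (rule expectation_mixture[OF ind[unfolded indep_vec_mat_def]])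
    show "disjoint_family_on G (signs J)"
      unfolding disjoint_family_on_def
    proof (intro ballI impI)
      fix s t assume "s \<in> signs J" "t \<in> signs J" "s \<noteq> t"
      \<comment> \<open>Extensionality places the disagreement of two distinct patterns inside
        \<open>J\<close>, where the events detect it.\<close>
      then obtain j where "j \<in> J" "s j \<noteq> t j"
        by (metis PiE_ext signs_def)
      then show "G s \<inter> G t = {}" by (auto simp: G_def)
    qed
    show "(\<Sum>s\<in>signs J. prob (G s)) = 1"
      using finJ by (simp add: prG card_signs power_one_over)
  qed (use finJ GF h X in \<open>auto simp: G_def\<close>)
  also have "\<dots> = (\<Sum>s\<in>signs J. expectation (h s)) / 2 ^ card J"
    by (simp add: prG power_one_over sum_divide_distrib)
  finally show ?thesis .
qed

section \<open>Symmetrization of suprema with a ghost copy\<close>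

lemma integrable_cSUP:
  fixes F :: "'t \<Rightarrow> 'a \<Rightarrow> real"
  assumes "countable T" "T \<noteq> {}" "\<And>t. t \<in> T \<Longrightarrow> F t \<in> borel_measurable N"
    and "integrable N G" "\<And>t x. t \<in> T \<Longrightarrow> x \<in> space N \<Longrightarrow> \<bar>F t x\<bar> \<le> G x"
  shows "integrable N (\<lambda>x. SUP t\<in>T. F t x)"
proof (rule Bochner_Integration.integrable_bound[OF assms(4)])
  show "(\<lambda>x. SUP t\<in>T. F t x) \<in> borel_measurable N"
    using assms(1,3,5) by (intro borel_measurable_cSUP bdd_aboveI2) (auto intro: abs_le_D1)
  have "\<bar>SUP t\<in>T. F t x\<bar> \<le> G x" if "x \<in> space N" for x
    using assms(2,5) that by (intro cSup_abs_le) auto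
  then show "AE x in N. norm (SUP t\<in>T. F t x) \<le> norm (G x)"
    by (intro AE_I2) force
qed

text \<open>A ghost copy: \<open>N\<close> carries two independent copies of every \<open>W k\<close>, indexed by \<open>bool\<close>.
  Jensen removes the centering at the price of the second copy, and exchanging the copies in the
  coordinates where a sign is negative preserves \<open>N\<close>.\<close>
lemma (in prob_space) symmetrization:
  fixes W :: "'k \<Rightarrow> 'a \<Rightarrow> 'b" and f :: "'t \<Rightarrow> 'k \<Rightarrow> 'b \<Rightarrow> real"
  assumes K: "finite K" "K \<noteq> {}" and ind: "indep_vars S W K"
    and T: "countable T" "T \<noteq> {}"
    and f: "\<And>t k. t \<in> T \<Longrightarrow> k \<in> K \<Longrightarrow> f t k \<in> borel_measurable (S k)"
    and g: "\<And>k. k \<in> K \<Longrightarrow> g k \<in> borel_measurable (S k)"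
      "\<And>k. k \<in> K \<Longrightarrow> integrable M (\<lambda>\<omega>. g k (W k \<omega>))"
    and fg: "\<And>t k x. t \<in> T \<Longrightarrow> k \<in> K \<Longrightarrow> x \<in> space (S k) \<Longrightarrow> \<bar>f t k x\<bar> \<le> g k x"
  shows "expectation (\<lambda>\<omega>. SUP t\<in>T. \<Sum>k\<in>K. f t k (W k \<omega>))
    \<le> (SUP t\<in>T. expectation (\<lambda>\<omega>. \<Sum>k\<in>K. f t k (W k \<omega>)))
      + 2 * ((\<Sum>s\<in>signs K. expectation (\<lambda>\<omega>. SUP t\<in>T. \<Sum>k\<in>K. s k * f t k (W k \<omega>))) / 2 ^ card K)"
proof -
  have W [measurable]: "k \<in> K \<Longrightarrow> random_variable (S k) (W k)" for k
    using ind by (auto simp: indep_vars_def)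
  \<comment> \<open>The locale for products asks for a probability measure at every index, so
    indices outside \<open>K\<close> receive a point mass.\<close>
  define P where "P i = (if fst i \<in> K then distr M (S (fst i)) (W (fst i))
      else return (count_space UNIV) undefined)" for i :: "'k \<times> bool"
  have prob_P: "prob_space (P i)" for i
    by (auto simp: P_def intro!: prob_space_distr prob_space_return W)
  interpret P: product_prob_space P
    by (intro product_prob_spaceI prob_P)
  have sets_P: "sets (P i) = sets (S (fst i))" if "fst i \<in> K" for i
    using that by (simp add: P_def)
  have comp: "(\<lambda>x. h (x i)) \<in> borel_measurable (PiM L P)"
    if "i \<in> L" "fst i \<in> K" "h \<in> borel_measurable (S (fst i))" for i L and h :: "'b \<Rightarrow> real"
  proof -
    have "h \<in> borel_measurable (P i)"
      using that(3) measurable_cong_sets[OF sets_P[OF that(2)] refl] by blast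
    with measurable_component_singleton[OF that(1), of P] show ?thesis
      by (rule measurable_compose)
  qed
  have distr_comp: "distr (PiM L P) (P i) (\<lambda>x. x i) = distr M (S (fst i)) (W (fst i))"
    if "i \<in> L" "fst i \<in> K" for i L
    using that prob_P distr_PiM_component[of L P i] by (simp add: P_def)
  have comp_integrable: "integrable (PiM L P) (\<lambda>x. h (x i))" and
    comp_integral: "(\<integral>x. h (x i) \<partial>PiM L P) = expectation (\<lambda>\<omega>. h (W (fst i) \<omega>))"
    if "i \<in> L" "fst i \<in> K" "h \<in> borel_measurable (S (fst i))"
      "integrable M (\<lambda>\<omega>. h (W (fst i) \<omega>))" for i L and h :: "'b \<Rightarrow> real"
  proof -
    have h: "h \<in> borel_measurable (P i)"
      using that(3) measurable_cong_sets[OF sets_P[OF that(2)] refl] by blast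
    have "integrable (distr (PiM L P) (P i) (\<lambda>x. x i)) h"
      unfolding distr_comp[OF that(1,2)] using that by (subst integrable_distr_eq) auto
    then show "integrable (PiM L P) (\<lambda>x. h (x i))"
      using h that(1) by (subst (asm) integrable_distr_eq) auto
    have "(\<integral>x. h (x i) \<partial>PiM L P) = integral\<^sup>L (distr (PiM L P) (P i) (\<lambda>x. x i)) h"
      using h that(1) by (subst integral_distr) auto
    also have "\<dots> = expectation (\<lambda>\<omega>. h (W (fst i) \<omega>))"
      unfolding distr_comp[OF that(1,2)] using that by (subst integral_distr) auto
    finally show "(\<integral>x. h (x i) \<partial>PiM L P) = expectation (\<lambda>\<omega>. h (W (fst i) \<omega>))" .
  qed
  have f_int: "integrable M (\<lambda>\<omega>. f t k (W k \<omega>))" if "t \<in> T" "k \<in> K" for t k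
  proof (rule Bochner_Integration.integrable_bound[OF g(2)[OF that(2)]])
    show "random_variable borel (\<lambda>\<omega>. f t k (W k \<omega>))"
      using f[OF that] W[OF that(2)] by measurable
    show "AE \<omega> in M. norm (f t k (W k \<omega>)) \<le> norm (g k (W k \<omega>))"
      using fg[OF that] measurable_space[OF W[OF that(2)]] by (intro AE_I2) force
  qed
  have sum_bound: "\<bar>\<Sum>k\<in>K. s k * f t k (y k)\<bar> \<le> (\<Sum>k\<in>K. g k (y k))"
    if "t \<in> T" "\<And>k. k \<in> K \<Longrightarrow> \<bar>s k\<bar> = 1" "\<And>k. k \<in> K \<Longrightarrow> y k \<in> space (S k)" for s t and y :: "'k \<Rightarrow> 'b"
    using that fg by (intro order_trans[OF sum_abs] sum_mono) (auto simp: abs_mult)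
  have space_comp: "x (k, b) \<in> space (S k)" if "x \<in> space (PiM L P)" "(k, b) \<in> L" "k \<in> K" for x k b L
    using that sets_eq_imp_space_eq[OF sets_P[of "(k, b)"]] by (auto simp: space_PiM PiE_iff)

  define R where "R s y = (SUP t\<in>T. \<Sum>k\<in>K. s k * f t k (y k))" for s and y :: "'k \<Rightarrow> 'b"
  have R_meas: "R s \<in> borel_measurable (PiM K S)" if "\<And>k. k \<in> K \<Longrightarrow> \<bar>s k\<bar> = 1" for s
    unfolding R_def
  proof (intro borel_measurable_cSUP T)
    fix t assume t: "t \<in> T"
    show "(\<lambda>y. \<Sum>k\<in>K. s k * f t k (y k)) \<in> borel_measurable (PiM K S)"
      using f[OF t] by (intro borel_measurable_sum borel_measurable_times borel_measurable_const 
          measurable_compose[OF measurable_component_singleton])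
  next
    fix y assume "y \<in> space (PiM K S)"
    then show "bdd_above ((\<lambda>t. \<Sum>k\<in>K. s k * f t k (y k)) ` T)"
      using sum_bound[of _ s y] that
      by (intro bdd_aboveI2[where M = "\<Sum>k\<in>K. g k (y k)"]) (auto simp: space_PiM PiE_iff abs_le_iff)
  qed
  \<comment> \<open>\<open>R s\<close> sees only the values on \<open>K\<close>, so families may be
    restricted to \<open>K\<close>, as elements of \<open>PiM K S\<close> are.\<close>
  have R_cong: "R s (\<lambda>k\<in>K. y k) = R s y" for s y
    by (simp add: R_def cong: sum.cong)
  have R_int: "integrable M (\<lambda>\<omega>. R s (\<lambda>k. W k \<omega>))" if "\<And>k. k \<in> K \<Longrightarrow> \<bar>s k\<bar> = 1" for s
    unfolding R_def
  proof (rule integrable_cSUP[OF T, where G = "\<lambda>\<omega>. \<Sum>k\<in>K. g k (W k \<omega>)"])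
    show "random_variable borel (\<lambda>\<omega>. \<Sum>k\<in>K. s k * f t k (W k \<omega>))" if "t \<in> T" for t
      using f_int[OF that] by auto
    show "integrable M (\<lambda>\<omega>. \<Sum>k\<in>K. g k (W k \<omega>))" using g(2) by simp
    show "\<bar>\<Sum>k\<in>K. s k * f t k (W k \<omega>)\<bar> \<le> (\<Sum>k\<in>K. g k (W k \<omega>))" if "t \<in> T" "\<omega> \<in> space M" for t \<omega>
      using that measurable_space[OF W] \<open>\<And>k. k \<in> K \<Longrightarrow> \<bar>s k\<bar> = 1\<close> by (intro sum_bound) auto
  qed

  \<comment> \<open>Independence of the \<open>W k\<close> enters here: it identifies their joint
    law with the product of the marginals, hence with the law of either copy.\<close>
  have copy: "distr (PiM L P) (PiM K S) (\<lambda>x. \<lambda>k\<in>K. x (k, b)) = distr M (PiM K S) (\<lambda>\<omega>. \<lambda>k\<in>K. W k \<omega>)"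
    if "K \<times> {b} \<subseteq> L" for L b
  proof -
    have "distr (PiM L P) (PiM K S) (\<lambda>x. \<lambda>k\<in>K. x (k, b))
        = distr (PiM L P) (PiM K (\<lambda>k. P (k, b))) (\<lambda>x. \<lambda>k\<in>K. x (k, b))"
      using sets_P by (intro distr_cong sets_PiM_cong) auto
    also have "\<dots> = PiM K (\<lambda>k. P (k, b))"
      using that prob_P by (intro distr_PiM_reindex) (auto intro: inj_onI)
    also have "\<dots> = PiM K (\<lambda>k. distr M (S k) (W k))"
      by (intro PiM_cong) (auto simp: P_def)
    also have "\<dots> = distr M (PiM K S) (\<lambda>\<omega>. \<lambda>k\<in>K. W k \<omega>)"
      using indep_vars_iff_distr_eq_PiM'[OF K(2) W] ind by simp
    finally show ?thesis .
  qed
  have restr_meas: "(\<lambda>x. \<lambda>k\<in>K. x (k, b)) \<in> PiM L P \<rightarrow>\<^sub>M PiM K S" if "K \<times> {b} \<subseteq> L" for L b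
  proof (rule measurable_restrict)
    fix k assume "k \<in> K"
    then have "(\<lambda>x. x (k, b)) \<in> PiM L P \<rightarrow>\<^sub>M P (k, b)"
      using that by (intro measurable_component_singleton) auto
    then show "(\<lambda>x. x (k, b)) \<in> PiM L P \<rightarrow>\<^sub>M S k"
      using measurable_cong_sets[OF refl sets_P[of "(k, b)"]] \<open>k \<in> K\<close> by auto
  qed
  have R_copy: "integrable (PiM L P) (\<lambda>x. R s (\<lambda>k. x (k, b)))"
      "(\<integral>x. R s (\<lambda>k. x (k, b)) \<partial>PiM L P) = expectation (\<lambda>\<omega>. R s (\<lambda>k. W k \<omega>))"
    if "\<And>k. k \<in> K \<Longrightarrow> \<bar>s k\<bar> = 1" "K \<times> {b} \<subseteq> L" for s b L
  proof -
    note [measurable] = restr_meas[OF that(2)]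
    have m2 [measurable]: "(\<lambda>\<omega>. \<lambda>k\<in>K. W k \<omega>) \<in> M \<rightarrow>\<^sub>M PiM K S"
      by (intro measurable_restrict W)
    note Rm [measurable] = R_meas[OF that(1)]
    have "integrable (distr M (PiM K S) (\<lambda>\<omega>. \<lambda>k\<in>K. W k \<omega>)) (R s)"
      using R_int[OF that(1)] by (subst integrable_distr_eq) (simp_all add: R_cong)
    then show "integrable (PiM L P) (\<lambda>x. R s (\<lambda>k. x (k, b)))"
      unfolding copy[OF that(2), symmetric] by (subst (asm) integrable_distr_eq) (simp_all add: R_cong)
    have "(\<integral>x. R s (\<lambda>k. x (k, b)) \<partial>PiM L P)
        = integral\<^sup>L (distr (PiM L P) (PiM K S) (\<lambda>x. \<lambda>k\<in>K. x (k, b))) (R s)"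
      by (subst integral_distr) (simp_all add: R_cong)
    also have "\<dots> = expectation (\<lambda>\<omega>. R s (\<lambda>k. W k \<omega>))"
      unfolding copy[OF that(2)] by (subst integral_distr) (simp_all add: R_cong)
    finally show "(\<integral>x. R s (\<lambda>k. x (k, b)) \<partial>PiM L P) = expectation (\<lambda>\<omega>. R s (\<lambda>k. W k \<omega>))" .
  qed

  let ?IF = "K \<times> {False}" and ?IT = "K \<times> {True}"
  define N where "N = PiM (K \<times> (UNIV :: bool set)) P"
  \<comment> \<open>The supremum of the differences of the two copies is the quantity that both
    bounds below are compared with: it dominates the centered process and is invariant in mean under
    exchanges of the copies.\<close>
  define H where "H x = (SUP t\<in>T. \<Sum>k\<in>K. f t k (x (k, False)) - f t k (x (k, True)))" for x :: "'k \<times> bool \<Rightarrow> 'b"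
  have diff_bound: "\<bar>\<Sum>k\<in>K. f t k (y k) - f t k (z k)\<bar> \<le> (\<Sum>k\<in>K. g k (y k)) + (\<Sum>k\<in>K. g k (z k))"
    if "t \<in> T" "\<And>k. k \<in> K \<Longrightarrow> y k \<in> space (S k)" "\<And>k. k \<in> K \<Longrightarrow> z k \<in> space (S k)" for t and y z :: "'k \<Rightarrow> 'b"
    using sum_bound[OF that(1), of "\<lambda>_. 1" y] sum_bound[OF that(1), of "\<lambda>_. 1" z] that(2,3)
    by (simp add: sum_subtractf abs_le_iff)
  have H_int: "integrable N H"
    unfolding H_def
  proof (rule integrable_cSUP[OF T, where G = "\<lambda>x. (\<Sum>k\<in>K. g k (x (k, False))) + (\<Sum>k\<in>K. g k (x (k, True)))"])
    show "(\<lambda>x. \<Sum>k\<in>K. f t k (x (k, False)) - f t k (x (k, True))) \<in> borel_measurable N" if "t \<in> T" for t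
      unfolding N_def using f[OF that] by (intro borel_measurable_sum borel_measurable_diff comp) auto
    show "integrable N (\<lambda>x. (\<Sum>k\<in>K. g k (x (k, False))) + (\<Sum>k\<in>K. g k (x (k, True))))"
      unfolding N_def using g
      by (intro Bochner_Integration.integrable_add Bochner_Integration.integrable_sum comp_integrable) auto
    show "\<bar>\<Sum>k\<in>K. f t k (x (k, False)) - f t k (x (k, True))\<bar>
        \<le> (\<Sum>k\<in>K. g k (x (k, False))) + (\<Sum>k\<in>K. g k (x (k, True)))" if "t \<in> T" "x \<in> space N" for t x
      using that by (intro diff_bound) (auto simp: N_def intro: space_comp)
  qed

  let ?C = "SUP t\<in>T. expectation (\<lambda>\<omega>. \<Sum>k\<in>K. f t k (W k \<omega>))"
  have C_bdd: "bdd_above ((\<lambda>t. expectation (\<lambda>\<omega>. \<Sum>k\<in>K. f t k (W k \<omega>))) ` T)"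
  proof (rule bdd_aboveI2)
    fix t assume t: "t \<in> T"
    show "expectation (\<lambda>\<omega>. \<Sum>k\<in>K. f t k (W k \<omega>)) \<le> expectation (\<lambda>\<omega>. \<Sum>k\<in>K. g k (W k \<omega>))"
    proof (intro integral_mono sum_mono)
      fix \<omega> k assume "\<omega> \<in> space M" "k \<in> K"
      then show "f t k (W k \<omega>) \<le> g k (W k \<omega>)"
        using fg[OF t, of k "W k \<omega>"] measurable_space[OF W] by (auto simp: abs_le_iff)
    qed (use f_int[OF t] g(2) in auto)
  qed
  have ghost: "expectation (\<lambda>\<omega>. R (\<lambda>_. 1) (\<lambda>k. W k \<omega>)) - ?C \<le> (\<integral>x. H x \<partial>N)"
  proof -
    interpret PF: prob_space "PiM ?IF P" by (intro prob_space_PiM prob_P)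
    interpret PT: prob_space "PiM ?IT P" by (intro prob_space_PiM prob_P)
    interpret PFT: pair_sigma_finite "PiM ?IF P" "PiM ?IT P" ..
    \<comment> \<open>Splitting the index set by copy exhibits \<open>N\<close> as a product of two
      spaces, so Fubini can integrate out the second copy while the first is held fixed.\<close>
    have un: "?IF \<union> ?IT = K \<times> UNIV" by (auto simp: UNIV_bool)
    have merge: "distr (PiM ?IF P \<Otimes>\<^sub>M PiM ?IT P) N (merge ?IF ?IT) = N"
      unfolding N_def un[symmetric] using K(1) by (intro P.distr_merge) auto
    have merge_meas [measurable]: "merge ?IF ?IT \<in> PiM ?IF P \<Otimes>\<^sub>M PiM ?IT P \<rightarrow>\<^sub>M N"
      unfolding N_def un[symmetric] by (rule measurable_merge)
    have H_merge: "H (merge ?IF ?IT (x, y)) = (SUP t\<in>T. \<Sum>k\<in>K. f t k (x (k, False)) - f t k (y (k, True)))" for x y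
      unfolding H_def by (intro SUP_cong sum.cong refl) (auto simp: merge_def)
    have HN: "H \<in> borel_measurable N" using H_int by auto
    have int2: "integrable (PiM ?IF P \<Otimes>\<^sub>M PiM ?IT P) (\<lambda>z. H (merge ?IF ?IT z))"
      using H_int HN by (subst (asm) merge[symmetric], subst (asm) integrable_distr_eq) auto
    have "(\<integral>x. H x \<partial>N) = (\<integral>z. H (merge ?IF ?IT z) \<partial>(PiM ?IF P \<Otimes>\<^sub>M PiM ?IT P))"
      using HN by (subst merge[symmetric], subst integral_distr) auto
    also have "\<dots> = (\<integral>x. (\<integral>y. H (merge ?IF ?IT (x, y)) \<partial>PiM ?IT P) \<partial>PiM ?IF P)"
      using PFT.integral_fst'[OF int2] by simp
    finally have H_eq: "(\<integral>x. H x \<partial>N) = (\<integral>x. (\<integral>y. H (merge ?IF ?IT (x, y)) \<partial>PiM ?IT P) \<partial>PiM ?IF P)" .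
    have "expectation (\<lambda>\<omega>. R (\<lambda>_. 1) (\<lambda>k. W k \<omega>)) - ?C
        = (\<integral>x. R (\<lambda>_. 1) (\<lambda>k. x (k, False)) - ?C \<partial>PiM ?IF P)"
      using R_copy[of "\<lambda>_. 1" False ?IF] by (simp add: PF.prob_space)
    also have "\<dots> \<le> (\<integral>x. (\<integral>y. H (merge ?IF ?IT (x, y)) \<partial>PiM ?IT P) \<partial>PiM ?IF P)"
    proof (intro integral_mono)
      show "integrable (PiM ?IF P) (\<lambda>x. R (\<lambda>_. 1) (\<lambda>k. x (k, False)) - ?C)"
        using R_copy(1)[of "\<lambda>_. 1" False ?IF] by simp
      show "integrable (PiM ?IF P) (\<lambda>x. \<integral>y. H (merge ?IF ?IT (x, y)) \<partial>PiM ?IT P)"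
        using PFT.integrable_fst'[OF int2] .
      fix x assume x: "x \<in> space (PiM ?IF P)"
      have xS: "x (k, False) \<in> space (S k)" if "k \<in> K" for k
        using space_comp[OF x, of k False] that by auto
      have yS: "y (k, True) \<in> space (S k)" if "k \<in> K" "y \<in> space (PiM ?IT P)" for k y
        using space_comp[OF that(2), of k True] that by auto
      let ?d = "\<lambda>t y. \<Sum>k\<in>K. f t k (x (k, False)) - f t k (y (k, True))"
      have d_int: "integrable (PiM ?IT P) (?d t)" if "t \<in> T" for t
        using f[OF that] f_int[OF that]
        by (intro Bochner_Integration.integrable_sum Bochner_Integration.integrable_diff comp_integrable) auto
      have sup_int: "integrable (PiM ?IT P) (\<lambda>y. SUP t\<in>T. ?d t y)"
      proof (rule integrable_cSUP[OF T, where G = "\<lambda>y. (\<Sum>k\<in>K. g k (x (k, False))) + (\<Sum>k\<in>K. g k (y (k, True)))"])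
        show "integrable (PiM ?IT P) (\<lambda>y. (\<Sum>k\<in>K. g k (x (k, False))) + (\<Sum>k\<in>K. g k (y (k, True))))"
          using g by (intro Bochner_Integration.integrable_add Bochner_Integration.integrable_sum comp_integrable) auto
      qed (use d_int xS yS in \<open>auto intro!: diff_bound\<close>)
      \<comment> \<open>The second copy integrates to the mean, so the integral of the difference is
        the centered sum. Bounding the mean by \<open>?C\<close> makes the right-hand side
        independent of \<open>t\<close>, and the supremum can be taken on the left.\<close>
      have "(\<Sum>k\<in>K. f t k (x (k, False))) \<le> (\<integral>y. (SUP t\<in>T. ?d t y) \<partial>PiM ?IT P) + ?C" if t: "t \<in> T" for t
      proof -
        have "(\<Sum>k\<in>K. f t k (x (k, False))) - expectation (\<lambda>\<omega>. \<Sum>k\<in>K. f t k (W k \<omega>)) = (\<integral>y. ?d t y \<partial>PiM ?IT P)"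
        proof -
          have "(\<integral>y. ?d t y \<partial>PiM ?IT P) = (\<Sum>k\<in>K. \<integral>y. f t k (x (k, False)) - f t k (y (k, True)) \<partial>PiM ?IT P)"
            using f[OF t] f_int[OF t]
            by (intro Bochner_Integration.integral_sum Bochner_Integration.integrable_diff comp_integrable) auto
          also have "\<dots> = (\<Sum>k\<in>K. f t k (x (k, False)) - expectation (\<lambda>\<omega>. f t k (W k \<omega>)))"
          proof (intro sum.cong refl)
            fix k assume k: "k \<in> K"
            have "integrable (PiM ?IT P) (\<lambda>y. f t k (y (k, True)))"
              using comp_integrable[of "(k, True)" ?IT "f t k"] f[OF t] f_int[OF t] k by simp
            moreover have "(\<integral>y. f t k (y (k, True)) \<partial>PiM ?IT P) = expectation (\<lambda>\<omega>. f t k (W k \<omega>))"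
              using comp_integral[of "(k, True)" ?IT "f t k"] f[OF t] f_int[OF t] k by simp
            ultimately show "(\<integral>y. f t k (x (k, False)) - f t k (y (k, True)) \<partial>PiM ?IT P)
                = f t k (x (k, False)) - expectation (\<lambda>\<omega>. f t k (W k \<omega>))"
              by (simp add: PT.prob_space)
          qed
          also have "\<dots> = (\<Sum>k\<in>K. f t k (x (k, False))) - expectation (\<lambda>\<omega>. \<Sum>k\<in>K. f t k (W k \<omega>))"
            using f_int[OF t] by (subst Bochner_Integration.integral_sum) (auto simp: sum_subtractf)
          finally show ?thesis by simp
        qed
        also have "\<dots> \<le> (\<integral>y. (SUP t\<in>T. ?d t y) \<partial>PiM ?IT P)"
        proof (intro integral_mono d_int sup_int t cSUP_upper)
          fix y assume y: "y \<in> space (PiM ?IT P)"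
          have "\<bar>?d t y\<bar> \<le> (\<Sum>k\<in>K. g k (x (k, False))) + (\<Sum>k\<in>K. g k (y (k, True)))" if "t \<in> T" for t
            using xS yS[OF _ y] that by (intro diff_bound) auto
          then show "bdd_above ((\<lambda>t. ?d t y) ` T)"
            by (intro bdd_aboveI2) (auto dest: abs_le_D1)
        qed
        finally have "(\<Sum>k\<in>K. f t k (x (k, False)))
            \<le> (\<integral>y. (SUP t\<in>T. ?d t y) \<partial>PiM ?IT P) + expectation (\<lambda>\<omega>. \<Sum>k\<in>K. f t k (W k \<omega>))"
          by simp
        moreover have "expectation (\<lambda>\<omega>. \<Sum>k\<in>K. f t k (W k \<omega>)) \<le> ?C"
          by (intro cSUP_upper t C_bdd)
        ultimately show ?thesis by linarith
      qed
      then have "R (\<lambda>_. 1) (\<lambda>k. x (k, False)) \<le> (\<integral>y. (SUP t\<in>T. ?d t y) \<partial>PiM ?IT P) + ?C"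
        unfolding R_def using T(2) by (intro cSUP_least) auto
      then show "R (\<lambda>_. 1) (\<lambda>k. x (k, False)) - ?C \<le> (\<integral>y. H (merge ?IF ?IT (x, y)) \<partial>PiM ?IT P)"
        unfolding H_merge by linarith
    qed
    finally show ?thesis unfolding H_eq .
  qed

  let ?E = "\<lambda>s. expectation (\<lambda>\<omega>. R s (\<lambda>k. W k \<omega>))"
  have swap: "(\<integral>x. H x \<partial>N) \<le> ?E s + ?E (\<lambda>k\<in>K. - s k)" if s: "s \<in> signs K" for s
  proof -
    \<comment> \<open>The two copies are exchanged exactly at the coordinates with negative sign.
      \<open>P i\<close> depends only on \<open>fst i\<close>, so this reindexing leaves
      \<open>N\<close> invariant while it turns each difference into its signed version.\<close>
    define \<sigma> where "\<sigma> i = (fst i, if s (fst i) = 1 then snd i else \<not> snd i)" for i :: "'k \<times> bool"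
    let ?sw = "\<lambda>x. \<lambda>i\<in>K \<times> (UNIV :: bool set). x (\<sigma> i) :: 'b"
    have P\<sigma>: "P (\<sigma> i) = P i" for i by (simp add: P_def \<sigma>_def)
    have "inj_on \<sigma> (K \<times> UNIV)" by (auto simp: inj_on_def \<sigma>_def split: if_splits)
    moreover have "\<sigma> \<in> K \<times> UNIV \<rightarrow> K \<times> UNIV" by (auto simp: \<sigma>_def)
    ultimately have dN: "distr N N ?sw = N"
      using distr_PiM_reindex[where M = P and f = \<sigma> and I = "K \<times> UNIV" and K = "K \<times> UNIV", OF prob_P]
      unfolding P\<sigma> N_def by blast
    have sw_meas: "?sw \<in> N \<rightarrow>\<^sub>M N"
      unfolding N_def
    proof (intro measurable_restrict)
      fix i assume "i \<in> K \<times> (UNIV :: bool set)"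
      then have "(\<lambda>x. x (\<sigma> i)) \<in> PiM (K \<times> UNIV) P \<rightarrow>\<^sub>M P (\<sigma> i)"
        by (intro measurable_component_singleton) (auto simp: \<sigma>_def)
      then show "(\<lambda>x. x (\<sigma> i)) \<in> PiM (K \<times> UNIV) P \<rightarrow>\<^sub>M P i" by (simp add: P\<sigma>)
    qed
    have s1: "\<bar>s k\<bar> = 1" "\<bar>(\<lambda>k\<in>K. - s k) k\<bar> = 1" if "k \<in> K" for k
      using abs_signs[OF s] that by auto
    have HN: "H \<in> borel_measurable N" using H_int by auto
    have "(\<integral>x. H x \<partial>N) = (\<integral>x. H (?sw x) \<partial>N)"
      using HN sw_meas by (subst dN[symmetric], subst integral_distr) auto
    \<comment> \<open>The supremum of a sum is at most the sum of the suprema; this separates the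
      copies, the second one with the opposite signs.\<close>
    also have "\<dots> \<le> (\<integral>x. R s (\<lambda>k. x (k, False)) + R (\<lambda>k\<in>K. - s k) (\<lambda>k. x (k, True)) \<partial>N)"
    proof (intro integral_mono)
      show "integrable N (\<lambda>x. H (?sw x))"
        using H_int HN sw_meas by (subst (asm) dN[symmetric], subst (asm) integrable_distr_eq) auto
      show "integrable N (\<lambda>x. R s (\<lambda>k. x (k, False)) + R (\<lambda>k\<in>K. - s k) (\<lambda>k. x (k, True)))"
        unfolding N_def using s1 by (intro Bochner_Integration.integrable_add R_copy) auto
      fix x assume x: "x \<in> space N"
      have xS: "x (k, b) \<in> space (S k)" if "k \<in> K" for k b
        using space_comp[of x "K \<times> UNIV" k b] x that by (auto simp: N_def)
      have up: "(\<Sum>k\<in>K. s' k * f t k (x (k, b))) \<le> R s' (\<lambda>k. x (k, b))"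
        if "t \<in> T" "\<And>k. k \<in> K \<Longrightarrow> \<bar>s' k\<bar> = 1" for s' t b
        unfolding R_def
      proof (rule cSUP_upper[OF that(1)])
        show "bdd_above ((\<lambda>t. \<Sum>k\<in>K. s' k * f t k (x (k, b))) ` T)"
          using sum_bound[of _ s' "\<lambda>k. x (k, b)"] that(2) xS
          by (intro bdd_aboveI2[where M = "\<Sum>k\<in>K. g k (x (k, b))"]) (auto simp: abs_le_iff)
      qed
      show "H (?sw x) \<le> R s (\<lambda>k. x (k, False)) + R (\<lambda>k\<in>K. - s k) (\<lambda>k. x (k, True))"
        unfolding H_def
      proof (rule cSUP_least[OF T(2)])
        fix t assume t: "t \<in> T"
        have "(\<Sum>k\<in>K. f t k (?sw x (k, False)) - f t k (?sw x (k, True)))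
            = (\<Sum>k\<in>K. s k * f t k (x (k, False)) + (\<lambda>k\<in>K. - s k) k * f t k (x (k, True)))"
        proof (intro sum.cong refl)
          fix k assume k: "k \<in> K"
          then have "s k = 1 \<or> s k = -1" using s by (auto simp: signs_def dest: PiE_mem)
          then show "f t k (?sw x (k, False)) - f t k (?sw x (k, True))
              = s k * f t k (x (k, False)) + (\<lambda>k\<in>K. - s k) k * f t k (x (k, True))"
            using k by (auto simp: \<sigma>_def)
        qed
        also have "\<dots> \<le> R s (\<lambda>k. x (k, False)) + R (\<lambda>k\<in>K. - s k) (\<lambda>k. x (k, True))"
          unfolding sum.distrib using t s1 by (intro add_mono up) auto
        finally show "(\<Sum>k\<in>K. f t k (?sw x (k, False)) - f t k (?sw x (k, True)))
            \<le> R s (\<lambda>k. x (k, False)) + R (\<lambda>k\<in>K. - s k) (\<lambda>k. x (k, True))" .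
      qed
    qed
    also have "\<dots> = ?E s + ?E (\<lambda>k\<in>K. - s k)"
      using R_copy[of s False "K \<times> UNIV"] R_copy[of "\<lambda>k\<in>K. - s k" True "K \<times> UNIV"] s1
      by (simp add: N_def Sigma_mono)
    finally show ?thesis .
  qed
  \<comment> \<open>The left-hand side of \<open>swap\<close> is free of \<open>s\<close>, so
    averaging over all patterns costs nothing there. On the right, \<open>s\<close> and its negative
    contribute equally.\<close>
  have "2 ^ card K * (\<integral>x. H x \<partial>N) = (\<Sum>s\<in>signs K. (\<integral>x. H x \<partial>N))"
    using K(1) by (simp add: card_signs)
  also have "\<dots> \<le> (\<Sum>s\<in>signs K. ?E s + ?E (\<lambda>k\<in>K. - s k))"
    by (intro sum_mono swap)
  also have "\<dots> = 2 * (\<Sum>s\<in>signs K. ?E s)"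
    using sum_signs_uminus[where F = ?E] by (simp add: sum.distrib)
  finally have "(\<integral>x. H x \<partial>N) \<le> 2 * ((\<Sum>s\<in>signs K. ?E s) / 2 ^ card K)"
    by (simp add: field_simps)
  with ghost have "?E (\<lambda>_. 1) \<le> ?C + 2 * ((\<Sum>s\<in>signs K. ?E s) / 2 ^ card K)"
    by linarith
  then show ?thesis by (simp add: R_def)
qed

section \<open>Random matrices\<close>

text \<open>A majorant free of both weights: \<open>a\<close> stands for the signs and
  \<open>b\<close> for the coordinates of the dual vector.\<close>

lemma abs_column_sum_le:
  fixes Z :: "nat \<times> nat \<Rightarrow> real"
  assumes "\<And>j. j < m \<Longrightarrow> \<bar>a j\<bar> \<le> 1" "\<And>j. j < m \<Longrightarrow> \<bar>b j\<bar> \<le> 1"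
  shows "\<bar>\<Sum>j<m. a j * Z (j, k) * b j\<bar> \<le> (\<Sum>j<m. \<bar>Z (j, k)\<bar>)"
proof (intro order_trans[OF sum_abs] sum_mono)
  fix j assume "j \<in> {..<m}"
  then have "\<bar>a j\<bar> * \<bar>b j\<bar> \<le> 1" using assms[of j] by (intro mult_le_one) auto
  then have "(\<bar>a j\<bar> * \<bar>b j\<bar>) * \<bar>Z (j, k)\<bar> \<le> 1 * \<bar>Z (j, k)\<bar>" by (intro mult_right_mono) auto
  then show "\<bar>a j * Z (j, k) * b j\<bar> \<le> \<bar>Z (j, k)\<bar>" by (simp add: abs_mult mult_ac)
qed

text \<open>A unit vector \<open>u\<close> dual to \<open>A *\<^sub>v v\<close> turns its norm into
  a double sum. After the sums are exchanged, each \<open>v $ k\<close> is bounded by the maximum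
  norm of \<open>v\<close>.\<close>

lemma opnorm_inf_to_le:
  assumes "1 \<le> p" "1 / p + 1 / q = 1" "A \<in> carrier_mat m n" "1 \<le> m" "1 \<le> n"
    and C: "\<And>u. u \<in> carrier_vec m \<Longrightarrow> lp_norm q u = 1
      \<Longrightarrow> (\<Sum>k<n. \<bar>\<Sum>j<m. A $$ (j, k) * u $ j\<bar>) \<le> C"
  shows "opnorm_inf_to p A \<le> C"
  unfolding opnorm_inf_to_def
proof (rule cSUP_least)
  have dims [simp]: "dim_row A = m" "dim_col A = n" using assms(3) by auto
  \<comment> \<open>The supremum defining the norm must range over a nonempty set; the all-ones
    vector is a witness since \<open>n\<close> is positive.\<close>
  have "vec n (\<lambda>_. 1) \<noteq> (0\<^sub>v n :: real vec)"
    using assms(5) by (auto dest!: arg_cong[where f = "\<lambda>v. v $ 0"])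
  then have "vec n (\<lambda>_. 1) \<in> {u :: real vec. u \<in> carrier_vec (dim_col A) \<and> u \<noteq> 0\<^sub>v (dim_col A)}" by simp
  then show "{u :: real vec. u \<in> carrier_vec (dim_col A) \<and> u \<noteq> 0\<^sub>v (dim_col A)} \<noteq> {}" by blast
  fix v :: "real vec" assume "v \<in> {u \<in> carrier_vec (dim_col A). u \<noteq> 0\<^sub>v (dim_col A)}"
  then have v: "v \<in> carrier_vec n" "v \<noteq> 0\<^sub>v n" by auto
  then obtain i where "i < n" "v $ i \<noteq> 0" by (metis carrier_vecD eq_vecI index_zero_vec)
  moreover have v_le: "\<bar>v $ k\<bar> \<le> lp_norm \<infinity> v" if "k < n" for k
    using abs_le_lp_norm_top[of k v] v(1) that by simp
  ultimately have "lp_norm \<infinity> v > 0" by (metis less_le_trans zero_less_abs_iff)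
  have Av: "A *\<^sub>v v \<in> carrier_vec m" using assms(3) by (intro carrier_vecI) simp
  obtain u where u: "u \<in> carrier_vec m" "lp_norm q u = 1"
    "(\<Sum>j<m. (A *\<^sub>v v) $ j * u $ j) = lp_norm p (A *\<^sub>v v)"
    using lp_norm_attained[OF assms(1,2) Av assms(4)] .
  have "lp_norm p (A *\<^sub>v v) = (\<Sum>j<m. \<Sum>k<n. A $$ (j, k) * v $ k * u $ j)"
    unfolding u(3)[symmetric] using v(1)
    by (intro sum.cong) (auto simp: scalar_prod_def sum_distrib_right lessThan_atLeast0)
  also have "\<dots> = (\<Sum>k<n. v $ k * (\<Sum>j<m. A $$ (j, k) * u $ j))"
    by (subst sum.swap) (simp add: sum_distrib_left mult_ac)
  also have "\<dots> \<le> (\<Sum>k<n. lp_norm \<infinity> v * \<bar>\<Sum>j<m. A $$ (j, k) * u $ j\<bar>)"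
  proof (rule sum_mono)
    fix k assume "k \<in> {..<n}"
    have "v $ k * (\<Sum>j<m. A $$ (j, k) * u $ j) \<le> \<bar>v $ k\<bar> * \<bar>\<Sum>j<m. A $$ (j, k) * u $ j\<bar>"
      by (metis abs_ge_self abs_mult)
    also have "\<dots> \<le> lp_norm \<infinity> v * \<bar>\<Sum>j<m. A $$ (j, k) * u $ j\<bar>"
      using v_le \<open>k \<in> {..<n}\<close> by (intro mult_right_mono) auto
    finally show "v $ k * (\<Sum>j<m. A $$ (j, k) * u $ j) \<le> \<dots>" .
  qed
  also have "\<dots> \<le> lp_norm \<infinity> v * C"
    unfolding sum_distrib_left[symmetric] using C[OF u(1,2)] \<open>lp_norm \<infinity> v > 0\<close>
    by (intro mult_left_mono) auto
  finally show "lp_norm p (A *\<^sub>v v) / lp_norm \<infinity> v \<le> C"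
    using \<open>lp_norm \<infinity> v > 0\<close> by (simp add: divide_le_eq mult.commute)
qed

text \<open>The sum involves finitely many coordinates of \<open>u\<close>, hence is continuous in
  the product topology. This carries bounds from the countable dense set to the whole
  sphere.\<close>

lemma sum_abs_le_on_closure:
  fixes a :: "nat \<times> nat \<Rightarrow> real"
  assumes "u \<in> closure T" "\<And>t. t \<in> T \<Longrightarrow> (\<Sum>k<n. \<bar>\<Sum>j<m. a (j, k) * t j\<bar>) \<le> C"
  shows "(\<Sum>k<n. \<bar>\<Sum>j<m. a (j, k) * u j\<bar>) \<le> C"
proof -
  have "closed {u :: nat \<Rightarrow> real. (\<Sum>k<n. \<bar>\<Sum>j<m. a (j, k) * u j\<bar>) \<le> C}"
    by (intro closed_Collect_le continuous_intros continuous_on_product_coordinates)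
  then have "closure T \<subseteq> {u. (\<Sum>k<n. \<bar>\<Sum>j<m. a (j, k) * u j\<bar>) \<le> C}"
    using assms(2) by (intro closure_minimal) auto
  with assms(1) show ?thesis by auto
qed

lemma (in prob_space) indep_centered_matrixD:
  assumes "indep_centered_matrix m n Z"
  shows "indep_vars (\<lambda>_. borel) (\<lambda>jk \<omega>. Z \<omega> $$ jk) ({..<m} \<times> {..<n})"
    and "\<And>j k. j < m \<Longrightarrow> k < n \<Longrightarrow> integrable M (\<lambda>\<omega>. Z \<omega> $$ (j, k))"
    and "\<And>j k. j < m \<Longrightarrow> k < n \<Longrightarrow> expectation (\<lambda>\<omega>. Z \<omega> $$ (j, k)) = 0"
    and "\<And>\<omega>. \<omega> \<in> space M \<Longrightarrow> Z \<omega> \<in> carrier_mat m n"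
    and "\<And>j k. j < m \<Longrightarrow> k < n \<Longrightarrow> random_variable borel (\<lambda>\<omega>. Z \<omega> $$ (j, k))"
  using assms by (auto simp: indep_centered_matrix_def intro!: borel_measurable_integrable)

text \<open>The general symmetrization is applied with the columns as independent objects;
  contraction, applied for each \<omega> separately, removes the absolute values.\<close>

lemma (in prob_space) matrix_symmetrization:
  assumes Z: "indep_centered_matrix m n Z" and "1 \<le> n"
    and T: "countable T" "T \<noteq> {}" "\<And>u j. u \<in> T \<Longrightarrow> j < m \<Longrightarrow> \<bar>u j\<bar> \<le> 1"
  shows "expectation (\<lambda>\<omega>. SUP u\<in>T. \<Sum>k<n. \<bar>\<Sum>j<m. Z \<omega> $$ (j, k) * u j\<bar>)
    \<le> (SUP u\<in>T. expectation (\<lambda>\<omega>. \<Sum>k<n. \<bar>\<Sum>j<m. Z \<omega> $$ (j, k) * u j\<bar>))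
      + 2 * ((\<Sum>s\<in>signs {..<n}. expectation (\<lambda>\<omega>. SUP u\<in>T. \<Sum>k<n. s k * (\<Sum>j<m. Z \<omega> $$ (j, k) * u j))) / 2 ^ n)"
proof -
  note Zint [simp] = indep_centered_matrixD(2,5)[OF Z]
  let ?c = "\<lambda>\<omega> u k. \<Sum>j<m. Z \<omega> $$ (j, k) * u j"
  let ?g = "\<lambda>\<omega> k. \<Sum>j<m. \<bar>Z \<omega> $$ (j, k)\<bar>"
  have c_le: "\<bar>?c \<omega> u k\<bar> \<le> ?g \<omega> k" if "u \<in> T" for \<omega> u k
    using abs_column_sum_le[where a = "\<lambda>_. 1" and b = u and Z = "\<lambda>jk. Z \<omega> $$ jk" and k = k] T(3)[OF that]
    by simp
  \<comment> \<open>Columns are families over the disjoint index blocks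
    \<open>{..<m} \<times> {k}\<close>, so independence of the entries passes to them; each column
    thereby gets its own product space.\<close>
  have ind: "indep_vars (\<lambda>k. PiM ({..<m} \<times> {k}) (\<lambda>_. borel))
      (\<lambda>k \<omega>. restrict (\<lambda>jk. Z \<omega> $$ jk) ({..<m} \<times> {k})) {..<n}"
    by (rule indep_vars_restrict[OF indep_centered_matrixD(1)[OF Z]]) (auto simp: disjoint_family_on_def)
  have component: "(\<lambda>x. x (j, k)) \<in> borel_measurable (PiM ({..<m} \<times> {k}) (\<lambda>_. borel))"
    if "j \<in> {..<m}" for j k
    using that by (intro measurable_component_singleton) auto
  have "expectation (\<lambda>\<omega>. SUP u\<in>T. \<Sum>k<n. \<bar>\<Sum>j<m. restrict (\<lambda>jk. Z \<omega> $$ jk) ({..<m} \<times> {k}) (j, k) * u j\<bar>)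
    \<le> (SUP u\<in>T. expectation (\<lambda>\<omega>. \<Sum>k<n. \<bar>\<Sum>j<m. restrict (\<lambda>jk. Z \<omega> $$ jk) ({..<m} \<times> {k}) (j, k) * u j\<bar>))
      + 2 * ((\<Sum>s\<in>signs {..<n}. expectation (\<lambda>\<omega>. SUP u\<in>T.
          \<Sum>k<n. s k * \<bar>\<Sum>j<m. restrict (\<lambda>jk. Z \<omega> $$ jk) ({..<m} \<times> {k}) (j, k) * u j\<bar>)) / 2 ^ card {..<n})"
  proof (rule symmetrization[OF _ _ ind T(1,2), where f = "\<lambda>u k x. \<bar>\<Sum>j<m. x (j, k) * u j\<bar>"
        and g = "\<lambda>k x. \<Sum>j<m. \<bar>x (j, k)\<bar>"])
    show "{..<n} \<noteq> {}" using assms(2) by (auto simp: lessThan_empty_iff)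
    show "(\<lambda>x. \<bar>\<Sum>j<m. x (j, k) * u j\<bar>) \<in> borel_measurable (PiM ({..<m} \<times> {k}) (\<lambda>_. borel))" for u :: "nat \<Rightarrow> real" and k
      using component by (intro borel_measurable_abs borel_measurable_sum borel_measurable_times borel_measurable_const)
    show "(\<lambda>x. \<Sum>j<m. \<bar>x (j, k)\<bar>) \<in> borel_measurable (PiM ({..<m} \<times> {k}) (\<lambda>_. borel :: real measure))" for k
      using component by (intro borel_measurable_abs borel_measurable_sum)
    show "integrable M (\<lambda>\<omega>. \<Sum>j<m. \<bar>restrict (\<lambda>jk. Z \<omega> $$ jk) ({..<m} \<times> {k}) (j, k)\<bar>)"
      if "k \<in> {..<n}" for k
      using that by (intro Bochner_Integration.integrable_sum integrable_abs) auto
    show "\<bar>\<bar>\<Sum>j<m. x (j, k) * u j\<bar>\<bar> \<le> (\<Sum>j<m. \<bar>x (j, k)\<bar>)" if "u \<in> T" for u k and x :: "nat \<times> nat \<Rightarrow> real"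
      using abs_column_sum_le[where a = "\<lambda>_. 1" and b = u and Z = x and k = k] T(3)[OF that] by simp
  qed simp
  moreover have "(\<Sum>j<m. restrict (\<lambda>jk. Z \<omega> $$ jk) ({..<m} \<times> {k}) (j, k) * u j) = ?c \<omega> u k" for \<omega> u k
    by (intro sum.cong) auto
  ultimately have "expectation (\<lambda>\<omega>. SUP u\<in>T. \<Sum>k<n. \<bar>?c \<omega> u k\<bar>)
    \<le> (SUP u\<in>T. expectation (\<lambda>\<omega>. \<Sum>k<n. \<bar>?c \<omega> u k\<bar>))
      + 2 * ((\<Sum>s\<in>signs {..<n}. expectation (\<lambda>\<omega>. SUP u\<in>T. \<Sum>k<n. s k * \<bar>?c \<omega> u k\<bar>)) / 2 ^ n)"
    by (simp only: card_lessThan)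
  also have "(\<Sum>s\<in>signs {..<n}. expectation (\<lambda>\<omega>. SUP u\<in>T. \<Sum>k<n. s k * \<bar>?c \<omega> u k\<bar>))
      \<le> (\<Sum>s\<in>signs {..<n}. expectation (\<lambda>\<omega>. SUP u\<in>T. \<Sum>k<n. s k * ?c \<omega> u k))"
  proof -
    have c_meas: "random_variable borel (\<lambda>\<omega>. ?c \<omega> u k)" if "k < n" for u k
      using that by (intro borel_measurable_sum borel_measurable_times) auto
    have g_int: "integrable M (\<lambda>\<omega>. \<Sum>k<n. ?g \<omega> k)"
      by (intro Bochner_Integration.integrable_sum integrable_abs) auto
    \<comment> \<open>The function \<open>\<phi>\<close> is instantiated by \<open>abs\<close> and
      by the identity, the two sides of the contraction.\<close>
    have int: "integrable M (\<lambda>\<omega>. SUP u\<in>T. \<Sum>k<n. s k * \<phi> (?c \<omega> u k))"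
      if "s \<in> signs {..<n}" "\<phi> \<in> borel_measurable borel" "\<And>x. \<bar>\<phi> x\<bar> = \<bar>x\<bar>" for s and \<phi> :: "real \<Rightarrow> real"
    proof (rule integrable_cSUP[OF T(1,2) _ g_int])
      show "random_variable borel (\<lambda>\<omega>. \<Sum>k<n. s k * \<phi> (?c \<omega> u k))" for u
        using c_meas by (intro borel_measurable_sum borel_measurable_times measurable_compose[OF _ that(2)]) auto
      show "\<bar>\<Sum>k<n. s k * \<phi> (?c \<omega> u k)\<bar> \<le> (\<Sum>k<n. ?g \<omega> k)" if "u \<in> T" for u \<omega>
        using c_le[OF that] abs_signs[OF \<open>s \<in> signs {..<n}\<close>] \<open>\<And>x. \<bar>\<phi> x\<bar> = \<bar>x\<bar>\<close>
        by (intro order_trans[OF sum_abs] sum_mono) (auto simp: abs_mult)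
    qed
    have "(\<Sum>s\<in>signs {..<n}. expectation (\<lambda>\<omega>. SUP u\<in>T. \<Sum>k<n. s k * \<bar>?c \<omega> u k\<bar>))
        = expectation (\<lambda>\<omega>. \<Sum>s\<in>signs {..<n}. SUP u\<in>T. \<Sum>k<n. s k * \<bar>?c \<omega> u k\<bar>)"
      using int[of _ abs] by (intro Bochner_Integration.integral_sum[symmetric]) auto
    also have "\<dots> \<le> expectation (\<lambda>\<omega>. \<Sum>s\<in>signs {..<n}. SUP u\<in>T. \<Sum>k<n. s k * ?c \<omega> u k)"
    proof (intro integral_mono)
      show "integrable M (\<lambda>\<omega>. \<Sum>s\<in>signs {..<n}. SUP u\<in>T. \<Sum>k<n. s k * \<bar>?c \<omega> u k\<bar>)"
        using int[of _ abs] by (intro Bochner_Integration.integrable_sum) auto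
      show "integrable M (\<lambda>\<omega>. \<Sum>s\<in>signs {..<n}. SUP u\<in>T. \<Sum>k<n. s k * ?c \<omega> u k)"
        using int[of _ "\<lambda>x. x"] by (intro Bochner_Integration.integrable_sum) auto
      show "(\<Sum>s\<in>signs {..<n}. SUP u\<in>T. \<Sum>k<n. s k * \<bar>?c \<omega> u k\<bar>)
          \<le> (\<Sum>s\<in>signs {..<n}. SUP u\<in>T. \<Sum>k<n. s k * ?c \<omega> u k)" for \<omega>
        \<comment> \<open>The comparison condition is the reverse triangle inequality: taking
          absolute values is 1-Lipschitz.\<close>
        using rademacher_contraction[of "{..<n}" T "\<lambda>_. 0" 0 "?c \<omega>" "?g \<omega>" "\<lambda>u k. \<bar>?c \<omega> u k\<bar>"] T(2) c_le
        by (simp add: abs_triangle_ineq3)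
    qed
    also have "\<dots> = (\<Sum>s\<in>signs {..<n}. expectation (\<lambda>\<omega>. SUP u\<in>T. \<Sum>k<n. s k * ?c \<omega> u k))"
      using int[of _ "\<lambda>x. x"] by (intro Bochner_Integration.integral_sum) auto
    finally show ?thesis .
  qed
  finally show ?thesis
    by (simp add: divide_right_mono)
qed

section \<open>Sign averages of the random matrix\<close>

lemma (in prob_space) measurable_entry:
  assumes "jk \<in> D"
  shows "(\<lambda>\<omega>. Z \<omega> $$ jk) \<in> borel_measurable (vimage_algebra (space M)
      (\<lambda>\<omega>. \<lambda>jk\<in>D. Z \<omega> $$ jk) (PiM D (\<lambda>_. borel :: real measure)))" (is "_ \<in> borel_measurable ?V")
proof -
  have "(\<lambda>\<omega>. \<lambda>jk\<in>D. Z \<omega> $$ jk) \<in> ?V \<rightarrow>\<^sub>M PiM D (\<lambda>_. borel)"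
    by (rule measurable_vimage_algebra1) (auto simp: space_PiM)
  from measurable_compose[OF this measurable_component_singleton[OF assms]] assms
  show ?thesis by simp
qed

lemma (in prob_space) expectation_lp_norm_rademacher:
  assumes p: "1 \<le> p" "1 / p + 1 / q = 1" and mn: "1 \<le> m" "1 \<le> n"
    and Z: "indep_centered_matrix m n Z" and \<epsilon>: "rademacher_vector d \<epsilon>" "n \<le> d"
    and ind: "indep_vec_mat d m n \<epsilon> Z"
  shows "integrable M (\<lambda>\<omega>. lp_norm p (vec m (\<lambda>j. \<Sum>k<n. s k * Z \<omega> $$ (j, k))))"
    and "expectation (\<lambda>\<omega>. lp_norm p (finsum_vec TYPE(real) m (\<lambda>k. \<epsilon> \<omega> $ k \<cdot>\<^sub>v col (Z \<omega>) k) {..<n}))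
      = (\<Sum>s\<in>signs {..<n}. expectation (\<lambda>\<omega>. lp_norm p (vec m (\<lambda>j. \<Sum>k<n. s k * Z \<omega> $$ (j, k))))) / 2 ^ n"
proof -
  note Zint [simp] = indep_centered_matrixD(2,5)[OF Z] and Zcar = indep_centered_matrixD(4)[OF Z]
  show int: "integrable M (\<lambda>\<omega>. lp_norm p (vec m (\<lambda>j. \<Sum>k<n. s k * Z \<omega> $$ (j, k))))" for s
  proof (rule Bochner_Integration.integrable_bound)
    show "integrable M (\<lambda>\<omega>. \<Sum>j<m. \<bar>\<Sum>k<n. s k * Z \<omega> $$ (j, k)\<bar>)"
      by (intro Bochner_Integration.integrable_sum integrable_abs) auto
    show "random_variable borel (\<lambda>\<omega>. lp_norm p (vec m (\<lambda>j. \<Sum>k<n. s k * Z \<omega> $$ (j, k))))"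
      by (intro borel_measurable_lp_norm_vec borel_measurable_sum borel_measurable_times) auto
    have "0 \<le> lp_norm p (vec m f)" "lp_norm p (vec m f) \<le> (\<Sum>j<m. \<bar>f j\<bar>)" for f
      using lp_norm_nonneg[of "vec m f" p] lp_norm_le_sum[OF p _ mn(1), of "vec m f"] mn(1) by auto
    then show "AE \<omega> in M. norm (lp_norm p (vec m (\<lambda>j. \<Sum>k<n. s k * Z \<omega> $$ (j, k))))
        \<le> norm (\<Sum>j<m. \<bar>\<Sum>k<n. s k * Z \<omega> $$ (j, k)\<bar>)"
      by (intro AE_I2) (simp add: sum_nonneg)
  qed
  have eps [measurable]: "random_variable borel (\<lambda>\<omega>. \<epsilon> \<omega> $ k)" if "k < d" for k
    using \<epsilon>(1) that by (auto simp: rademacher_vector_def indep_vars_def)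
  \<comment> \<open>Reading the vector sum coordinatewise depends on the dimensions of
    \<open>Z \<omega>\<close>, which are known on the sample space only.\<close>
  have "finsum_vec TYPE(real) m (\<lambda>k. \<epsilon> \<omega> $ k \<cdot>\<^sub>v col (Z \<omega>) k) {..<n}
      = vec m (\<lambda>j. \<Sum>k<n. \<epsilon> \<omega> $ k * Z \<omega> $$ (j, k))" if "\<omega> \<in> space M" for \<omega>
  proof -
    have dims: "dim_row (Z \<omega>) = m" "dim_col (Z \<omega>) = n" using Zcar[OF that] by auto
    have car: "(\<lambda>k. \<epsilon> \<omega> $ k \<cdot>\<^sub>v col (Z \<omega>) k) \<in> {..<n} \<rightarrow> carrier_vec m"
      using dims by (auto intro!: carrier_vecI)
    show ?thesis
    proof (rule eq_vecI)
      show "dim_vec (finsum_vec TYPE(real) m (\<lambda>k. \<epsilon> \<omega> $ k \<cdot>\<^sub>v col (Z \<omega>) k) {..<n})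
          = dim_vec (vec m (\<lambda>j. \<Sum>k<n. \<epsilon> \<omega> $ k * Z \<omega> $$ (j, k)))"
        using finsum_vec_closed[OF car] by simp
      fix j assume "j < dim_vec (vec m (\<lambda>j. \<Sum>k<n. \<epsilon> \<omega> $ k * Z \<omega> $$ (j, k)))"
      then show "finsum_vec TYPE(real) m (\<lambda>k. \<epsilon> \<omega> $ k \<cdot>\<^sub>v col (Z \<omega>) k) {..<n} $ j
          = vec m (\<lambda>j. \<Sum>k<n. \<epsilon> \<omega> $ k * Z \<omega> $$ (j, k)) $ j"
        using index_finsum_vec[OF _ _ car, of j] dims by simp
    qed
  qed
  then have "expectation (\<lambda>\<omega>. lp_norm p (finsum_vec TYPE(real) m (\<lambda>k. \<epsilon> \<omega> $ k \<cdot>\<^sub>v col (Z \<omega>) k) {..<n}))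
      = expectation (\<lambda>\<omega>. lp_norm p (vec m (\<lambda>j. \<Sum>k<n. \<epsilon> \<omega> $ k * Z \<omega> $$ (j, k))))"
    by (intro Bochner_Integration.integral_cong) auto
  also have "\<dots> = (\<Sum>s\<in>signs {..<n}. expectation (\<lambda>\<omega>. lp_norm p (vec m (\<lambda>j. \<Sum>k<n. s k * Z \<omega> $$ (j, k))))) / 2 ^ card {..<n}"
  proof (rule expectation_rademacher_average[OF \<epsilon>(1) ind _ _ _ int])
    show "{..<n} \<subseteq> {..<d}" "{..<n} \<noteq> {}" using \<epsilon>(2) mn(2) by (auto simp: lessThan_empty_iff)
    show "random_variable borel (\<lambda>\<omega>. lp_norm p (vec m (\<lambda>j. \<Sum>k<n. \<epsilon> \<omega> $ k * Z \<omega> $$ (j, k))))"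
      using \<epsilon>(2) by (intro borel_measurable_lp_norm_vec borel_measurable_sum borel_measurable_times eps) auto
    show "(\<lambda>\<omega>. lp_norm p (vec m (\<lambda>j. \<Sum>k<n. s k * Z \<omega> $$ (j, k)))) \<in> borel_measurable
        (vimage_algebra (space M) (\<lambda>\<omega>. \<lambda>jk\<in>{..<m} \<times> {..<n}. Z \<omega> $$ jk) (PiM ({..<m} \<times> {..<n}) (\<lambda>_. borel)))" for s
      by (intro borel_measurable_lp_norm_vec borel_measurable_sum borel_measurable_times borel_measurable_const
          measurable_entry) auto
  qed (auto intro!: arg_cong[where f = "lp_norm p"] eq_vecI)
  finally show "expectation (\<lambda>\<omega>. lp_norm p (finsum_vec TYPE(real) m (\<lambda>k. \<epsilon> \<omega> $ k \<cdot>\<^sub>v col (Z \<omega>) k) {..<n}))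
      = (\<Sum>s\<in>signs {..<n}. expectation (\<lambda>\<omega>. lp_norm p (vec m (\<lambda>j. \<Sum>k<n. s k * Z \<omega> $$ (j, k))))) / 2 ^ n"
    by simp
qed

text \<open>For each sign pattern and each column, splitting by signs gives the factor 2; averaging
  over patterns restores \<epsilon>. The second bound is free of \<open>u\<close> and keeps the
  supremum over the dual sphere finite.\<close>

lemma (in prob_space) expectation_column_sums_rademacher:
  assumes mn: "1 \<le> m"
    and Z: "indep_centered_matrix m n Z" and \<epsilon>: "rademacher_vector d \<epsilon>" "m \<le> d"
    and ind: "indep_vec_mat d m n \<epsilon> Z" and u: "\<And>j. j < m \<Longrightarrow> \<bar>u j\<bar> \<le> 1"
  shows "expectation (\<lambda>\<omega>. \<Sum>k<n. \<bar>\<Sum>j<m. Z \<omega> $$ (j, k) * u j\<bar>)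
      \<le> 2 * expectation (\<lambda>\<omega>. \<Sum>k<n. \<bar>\<Sum>j<m. \<epsilon> \<omega> $ j * Z \<omega> $$ (j, k) * u j\<bar>)"
    and "expectation (\<lambda>\<omega>. \<Sum>k<n. \<bar>\<Sum>j<m. \<epsilon> \<omega> $ j * Z \<omega> $$ (j, k) * u j\<bar>)
      \<le> expectation (\<lambda>\<omega>. \<Sum>k<n. \<Sum>j<m. \<bar>Z \<omega> $$ (j, k)\<bar>)"
proof -
  note Zint [simp] = indep_centered_matrixD(2,5)[OF Z]
  let ?h = "\<lambda>s \<omega>. \<Sum>k<n. \<bar>\<Sum>j<m. s j * Z \<omega> $$ (j, k) * u j\<bar>"
  have eps [measurable]: "random_variable borel (\<lambda>\<omega>. \<epsilon> \<omega> $ k)" if "k < d" for k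
    using \<epsilon>(1) that by (auto simp: rademacher_vector_def indep_vars_def)
  have int: "integrable M (?h s)" for s
    by (intro Bochner_Integration.integrable_sum integrable_abs integrable_mult_left integrable_mult_right) auto
  have "expectation (\<lambda>\<omega>. \<Sum>k<n. \<bar>\<Sum>j<m. \<epsilon> \<omega> $ j * Z \<omega> $$ (j, k) * u j\<bar>)
      = (\<Sum>s\<in>signs {..<m}. expectation (?h s)) / 2 ^ card {..<m}"
  proof (rule expectation_rademacher_average[OF \<epsilon>(1) ind _ _ _ int])
    show "{..<m} \<subseteq> {..<d}" "{..<m} \<noteq> {}" using \<epsilon>(2) mn by (auto simp: lessThan_empty_iff)
    show "random_variable borel (\<lambda>\<omega>. \<Sum>k<n. \<bar>\<Sum>j<m. \<epsilon> \<omega> $ j * Z \<omega> $$ (j, k) * u j\<bar>)"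
      using \<epsilon>(2) by (intro borel_measurable_sum borel_measurable_abs borel_measurable_times eps) auto
    show "?h s \<in> borel_measurable
        (vimage_algebra (space M) (\<lambda>\<omega>. \<lambda>jk\<in>{..<m} \<times> {..<n}. Z \<omega> $$ jk) (PiM ({..<m} \<times> {..<n}) (\<lambda>_. borel)))" for s
      by (intro borel_measurable_sum borel_measurable_abs borel_measurable_times borel_measurable_const
          measurable_entry) auto
  qed auto
  then have avg: "expectation (\<lambda>\<omega>. \<Sum>k<n. \<bar>\<Sum>j<m. \<epsilon> \<omega> $ j * Z \<omega> $$ (j, k) * u j\<bar>)
      = (\<Sum>s\<in>signs {..<m}. expectation (?h s)) / 2 ^ m" by simp
  have const: "(\<Sum>s\<in>signs {..<m}. x) / 2 ^ m = x" for x :: real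
    by (simp add: card_signs)

  have "expectation (\<lambda>\<omega>. \<Sum>k<n. \<bar>\<Sum>j<m. Z \<omega> $$ (j, k) * u j\<bar>) \<le> 2 * expectation (?h s)"
    if s: "s \<in> signs {..<m}" for s
  proof -
    have "expectation (\<lambda>\<omega>. \<bar>\<Sum>j<m. Z \<omega> $$ (j, k) * u j\<bar>)
        \<le> 2 * expectation (\<lambda>\<omega>. \<bar>\<Sum>j<m. s j * Z \<omega> $$ (j, k) * u j\<bar>)" if k: "k < n" for k
    proof -
      have sum_col: "(\<Sum>jk\<in>{..<m} \<times> {k}. F jk) = (\<Sum>j<m. F (j, k))" for F :: "nat \<times> nat \<Rightarrow> real"
        using sum.cartesian_product[of "\<lambda>j k. F (j, k)" "{k}" "{..<m}"] by simp
      have "indep_vars (\<lambda>_. borel) (\<lambda>jk \<omega>. Z \<omega> $$ jk) ({..<m} \<times> {k})"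
        using k by (intro indep_vars_subset[OF indep_centered_matrixD(1)[OF Z]]) auto
      \<comment> \<open>The weights \<open>u j\<close> are absorbed into the variables, which stay
        independent and centered.\<close>
      then have "indep_vars (\<lambda>_. borel) (\<lambda>jk \<omega>. Z \<omega> $$ jk * u (fst jk)) ({..<m} \<times> {k})"
        by (rule indep_vars_compose2) auto
      from expectation_abs_sum_le_signed[OF _ this, where s = "\<lambda>jk. s (fst jk)"]
      show ?thesis
        using k indep_centered_matrixD(3)[OF Z] abs_signs[OF s] by (auto simp: sum_col mult.assoc)
    qed
    then have "(\<Sum>k<n. expectation (\<lambda>\<omega>. \<bar>\<Sum>j<m. Z \<omega> $$ (j, k) * u j\<bar>))
        \<le> (\<Sum>k<n. 2 * expectation (\<lambda>\<omega>. \<bar>\<Sum>j<m. s j * Z \<omega> $$ (j, k) * u j\<bar>))"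
      by (intro sum_mono) auto
    then show ?thesis
      by (subst (1 2) Bochner_Integration.integral_sum)
        (auto simp: sum_distrib_left intro!: Bochner_Integration.integrable_sum integrable_abs integrable_mult_left integrable_mult_right)
  qed
  then have "(\<Sum>s\<in>signs {..<m}. expectation (\<lambda>\<omega>. \<Sum>k<n. \<bar>\<Sum>j<m. Z \<omega> $$ (j, k) * u j\<bar>)) / 2 ^ m
      \<le> (\<Sum>s\<in>signs {..<m}. 2 * expectation (?h s)) / 2 ^ m"
    by (intro divide_right_mono sum_mono) auto
  then show "expectation (\<lambda>\<omega>. \<Sum>k<n. \<bar>\<Sum>j<m. Z \<omega> $$ (j, k) * u j\<bar>)
      \<le> 2 * expectation (\<lambda>\<omega>. \<Sum>k<n. \<bar>\<Sum>j<m. \<epsilon> \<omega> $ j * Z \<omega> $$ (j, k) * u j\<bar>)"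
    unfolding const avg by (simp flip: sum_distrib_left)

  have "expectation (?h s) \<le> expectation (\<lambda>\<omega>. \<Sum>k<n. \<Sum>j<m. \<bar>Z \<omega> $$ (j, k)\<bar>)"
    if "s \<in> signs {..<m}" for s
  proof (intro integral_mono int)
    show "integrable M (\<lambda>\<omega>. \<Sum>k<n. \<Sum>j<m. \<bar>Z \<omega> $$ (j, k)\<bar>)"
      by (intro Bochner_Integration.integrable_sum integrable_abs) auto
    show "?h s \<omega> \<le> (\<Sum>k<n. \<Sum>j<m. \<bar>Z \<omega> $$ (j, k)\<bar>)" for \<omega>
      using abs_signs[OF that] u
      by (intro sum_mono abs_column_sum_le[where Z = "\<lambda>jk. Z \<omega> $$ jk"]) auto
  qed
  then have "(\<Sum>s\<in>signs {..<m}. expectation (?h s)) / 2 ^ m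
      \<le> (\<Sum>s\<in>signs {..<m}. expectation (\<lambda>\<omega>. \<Sum>k<n. \<Sum>j<m. \<bar>Z \<omega> $$ (j, k)\<bar>)) / 2 ^ m"
    by (intro divide_right_mono sum_mono) auto
  then show "expectation (\<lambda>\<omega>. \<Sum>k<n. \<bar>\<Sum>j<m. \<epsilon> \<omega> $ j * Z \<omega> $$ (j, k) * u j\<bar>)
      \<le> expectation (\<lambda>\<omega>. \<Sum>k<n. \<Sum>j<m. \<bar>Z \<omega> $$ (j, k)\<bar>)"
    unfolding const avg .
qed

theorem theorem1:
  fixes M :: "'a measure" and p q :: ennreal and m n :: nat
    and Z :: "'a \<Rightarrow> real mat" and \<epsilon> :: "'a \<Rightarrow> real vec"
  assumes "prob_space M"
    and "1 \<le> p" and "1 / p + 1 / q = 1"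
    and "1 \<le> m" and "1 \<le> n"
    and "prob_space.indep_centered_matrix M m n Z"
    and "prob_space.rademacher_vector M (max m n) \<epsilon>"
    and "prob_space.indep_vec_mat M (max m n) m n \<epsilon> Z"
  shows "(\<integral>\<omega>. opnorm_inf_to p (Z \<omega>) \<partial>M)
    \<le> 2 * (\<integral>\<omega>. lp_norm p
              (finsum_vec TYPE(real) m (\<lambda>k. \<epsilon> \<omega> $ k \<cdot>\<^sub>v col (Z \<omega>) k) {..<n}) \<partial>M)
      + 2 * (SUP u \<in> {u \<in> carrier_vec m. lp_norm q u = 1}.
              (\<integral>\<omega>. (\<Sum>k<n. \<bar>\<Sum>j<m. \<epsilon> \<omega> $ j * Z \<omega> $$ (j, k) * u $ j\<bar>) \<partial>M))"
proof -
  interpret prob_space M by fact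
  note p = assms(2,3) and Z = assms(6) and rad = assms(7) and ind = assms(8)
  note Zint [simp] = indep_centered_matrixD(2,5)[OF Z] and Zcar = indep_centered_matrixD(4)[OF Z]
  define U where "U = {u \<in> carrier_vec m. lp_norm q u = 1}"
  have U_le: "\<bar>u $ j\<bar> \<le> 1" if "u \<in> U" "j < m" for u j
    using abs_le_lp_norm[OF conjugate_exponent_ge_1[OF p(2)], of j u] that by (auto simp: U_def)
  \<comment> \<open>Coordinates from \<open>m\<close> on are unconstrained. The dense set is taken
    inside \<open>?U\<close>, so that each of its points still yields a unit vector.\<close>
  let ?U = "{f :: nat \<Rightarrow> real. lp_norm q (vec m f) = 1}"
  obtain T where T: "countable T" "T \<subseteq> ?U" "?U \<subseteq> closure T"
    by (rule separable)
  have TU: "vec m t \<in> U" if "t \<in> T" for t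
    using T(2) that by (auto simp: U_def)
  have T_le: "\<bar>t j\<bar> \<le> 1" if "t \<in> T" "j < m" for t j
    using U_le[OF TU[OF that(1)] that(2)] that(2) by simp
  have U_closure: "(\<lambda>j. u $ j) \<in> closure T" if "u \<in> U" for u
  proof -
    have "vec m (\<lambda>j. u $ j) = u" using that by (intro eq_vecI) (auto simp: U_def)
    then have "(\<lambda>j. u $ j) \<in> ?U" using that by (simp add: U_def)
    then show ?thesis using T(3) by blast
  qed
  \<comment> \<open>Even the zero vector has a dual unit vector, so the sphere is nonempty; by
    density so is \<open>T\<close>.\<close>
  obtain u0 where "u0 \<in> U"
    using lp_norm_attained[OF p zero_carrier_vec assms(4)] by (auto simp: U_def)
  then have "T \<noteq> {}" using U_closure by force

  let ?c = "\<lambda>\<omega> u k. \<Sum>j<m. Z \<omega> $$ (j, k) * u j"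
  let ?F = "\<lambda>\<omega>. SUP u\<in>T. \<Sum>k<n. \<bar>?c \<omega> u k\<bar>"
  have G_int: "integrable M (\<lambda>\<omega>. \<Sum>k<n. \<Sum>j<m. \<bar>Z \<omega> $$ (j, k)\<bar>)"
    by (intro Bochner_Integration.integrable_sum integrable_abs) auto
  have c_le: "\<bar>?c \<omega> u k\<bar> \<le> (\<Sum>j<m. \<bar>Z \<omega> $$ (j, k)\<bar>)" if "u \<in> T" for \<omega> u k
    using abs_column_sum_le[where a = "\<lambda>_. 1" and b = u and Z = "\<lambda>jk. Z \<omega> $$ jk" and k = k] T_le[OF that]
    by simp
  then have sum_c_le: "(\<Sum>k<n. \<bar>?c \<omega> u k\<bar>) \<le> (\<Sum>k<n. \<Sum>j<m. \<bar>Z \<omega> $$ (j, k)\<bar>)" if "u \<in> T" for \<omega> u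
    using that by (intro sum_mono)
  have F_upper: "(\<Sum>k<n. \<bar>?c \<omega> u k\<bar>) \<le> ?F \<omega>" if "u \<in> T" for \<omega> u
    using that sum_c_le by (intro cSUP_upper bdd_aboveI2)
  have F_int: "integrable M ?F"
  proof (rule integrable_cSUP[OF T(1) \<open>T \<noteq> {}\<close> _ G_int])
    show "random_variable borel (\<lambda>\<omega>. \<Sum>k<n. \<bar>?c \<omega> u k\<bar>)" for u
      by (intro borel_measurable_sum borel_measurable_abs borel_measurable_times) auto
  qed (use sum_c_le in \<open>auto simp: sum_nonneg\<close>)
  have "expectation (\<lambda>\<omega>. opnorm_inf_to p (Z \<omega>)) \<le> expectation ?F"
  \<comment> \<open>Measurability of the operator norm is not needed: a non-integrable function has integral 0.\<close>
  proof (rule integral_mono'[OF F_int])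
    fix \<omega> assume "\<omega> \<in> space M"
    then show "opnorm_inf_to p (Z \<omega>) \<le> ?F \<omega>"
      using sum_abs_le_on_closure[OF U_closure F_upper]
      by (intro opnorm_inf_to_le[OF p Zcar assms(4,5)]) (auto simp: U_def)
    obtain t where "t \<in> T" using \<open>T \<noteq> {}\<close> by blast
    show "0 \<le> ?F \<omega>" by (rule order_trans[OF _ F_upper[OF \<open>t \<in> T\<close>]]) (simp add: sum_nonneg)
  qed
  also have "\<dots> \<le> (SUP u\<in>T. expectation (\<lambda>\<omega>. \<Sum>k<n. \<bar>?c \<omega> u k\<bar>))
      + 2 * ((\<Sum>s\<in>signs {..<n}. expectation (\<lambda>\<omega>. SUP u\<in>T. \<Sum>k<n. s k * ?c \<omega> u k)) / 2 ^ n)"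
    by (rule matrix_symmetrization[OF Z assms(5) T(1) \<open>T \<noteq> {}\<close>]) (rule T_le)
  also have "(SUP u\<in>T. expectation (\<lambda>\<omega>. \<Sum>k<n. \<bar>?c \<omega> u k\<bar>))
      \<le> 2 * (SUP u\<in>U. expectation (\<lambda>\<omega>. \<Sum>k<n. \<bar>\<Sum>j<m. \<epsilon> \<omega> $ j * Z \<omega> $$ (j, k) * u $ j\<bar>))"
    (is "_ \<le> 2 * ?S")
  proof (rule cSUP_least[OF \<open>T \<noteq> {}\<close>])
    fix t assume t: "t \<in> T"
    have "expectation (\<lambda>\<omega>. \<Sum>k<n. \<bar>?c \<omega> t k\<bar>)
        \<le> 2 * expectation (\<lambda>\<omega>. \<Sum>k<n. \<bar>\<Sum>j<m. \<epsilon> \<omega> $ j * Z \<omega> $$ (j, k) * t j\<bar>)"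
      by (intro expectation_column_sums_rademacher(1)[OF assms(4) Z rad _ ind] T_le[OF t]) auto
    also have "expectation (\<lambda>\<omega>. \<Sum>k<n. \<bar>\<Sum>j<m. \<epsilon> \<omega> $ j * Z \<omega> $$ (j, k) * t j\<bar>)
        = expectation (\<lambda>\<omega>. \<Sum>k<n. \<bar>\<Sum>j<m. \<epsilon> \<omega> $ j * Z \<omega> $$ (j, k) * vec m t $ j\<bar>)"
      by simp
    also have "\<dots> \<le> ?S"
    proof (intro cSUP_upper TU t bdd_aboveI2)
      fix u assume "u \<in> U"
      then show "expectation (\<lambda>\<omega>. \<Sum>k<n. \<bar>\<Sum>j<m. \<epsilon> \<omega> $ j * Z \<omega> $$ (j, k) * u $ j\<bar>)
          \<le> expectation (\<lambda>\<omega>. \<Sum>k<n. \<Sum>j<m. \<bar>Z \<omega> $$ (j, k)\<bar>)"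
        using U_le by (intro expectation_column_sums_rademacher(2)[OF assms(4) Z rad _ ind]) auto
    qed
    finally show "expectation (\<lambda>\<omega>. \<Sum>k<n. \<bar>?c \<omega> t k\<bar>) \<le> 2 * ?S" by simp
  qed
  \<comment> \<open>After the sums are exchanged, the signed process at \<open>t\<close> is the
    pairing of the signed column sum with \<open>t\<close>, so Hoelder's inequality bounds its
    supremum by the norm, for each pattern and each \<omega>.\<close>
  also have "(\<Sum>s\<in>signs {..<n}. expectation (\<lambda>\<omega>. SUP u\<in>T. \<Sum>k<n. s k * ?c \<omega> u k))
      \<le> (\<Sum>s\<in>signs {..<n}. expectation (\<lambda>\<omega>. lp_norm p (vec m (\<lambda>j. \<Sum>k<n. s k * Z \<omega> $$ (j, k)))))"
  proof (intro sum_mono integral_mono')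
    fix s \<omega> assume "\<omega> \<in> space M"
    show "(SUP u\<in>T. \<Sum>k<n. s k * ?c \<omega> u k) \<le> lp_norm p (vec m (\<lambda>j. \<Sum>k<n. s k * Z \<omega> $$ (j, k)))"
    proof (rule cSUP_least[OF \<open>T \<noteq> {}\<close>])
      fix t assume t: "t \<in> T"
      have "(\<Sum>k<n. s k * ?c \<omega> t k) = (\<Sum>j<m. (\<Sum>k<n. s k * Z \<omega> $$ (j, k)) * t j)"
        unfolding sum_distrib_left sum_distrib_right by (subst sum.swap) (simp add: mult.assoc)
      also have "\<dots> = (\<Sum>j<m. vec m (\<lambda>j. \<Sum>k<n. s k * Z \<omega> $$ (j, k)) $ j * vec m t $ j)"
        by simp
      also have "\<dots> \<le> lp_norm p (vec m (\<lambda>j. \<Sum>k<n. s k * Z \<omega> $$ (j, k)))"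
        using TU[OF t] by (intro holder_lp_norm[OF p]) (auto simp: U_def)
      finally show "(\<Sum>k<n. s k * ?c \<omega> t k) \<le> lp_norm p (vec m (\<lambda>j. \<Sum>k<n. s k * Z \<omega> $$ (j, k)))" .
    qed
    show "0 \<le> lp_norm p (vec m (\<lambda>j. \<Sum>k<n. s k * Z \<omega> $$ (j, k)))"
      using assms(4) by (intro lp_norm_nonneg) simp
  qed (intro expectation_lp_norm_rademacher(1)[OF p assms(4,5) Z rad _ ind], simp)
  also have "2 * ((\<Sum>s\<in>signs {..<n}. expectation (\<lambda>\<omega>. lp_norm p (vec m (\<lambda>j. \<Sum>k<n. s k * Z \<omega> $$ (j, k))))) / 2 ^ n)
      = 2 * expectation (\<lambda>\<omega>. lp_norm p (finsum_vec TYPE(real) m (\<lambda>k. \<epsilon> \<omega> $ k \<cdot>\<^sub>v col (Z \<omega>) k) {..<n}))"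
    by (subst expectation_lp_norm_rademacher(2)[OF p assms(4,5) Z rad _ ind]) auto
  finally show ?thesis
    unfolding U_def by (simp add: divide_right_mono add.commute)
qed

end
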